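(* The operator $L:\operatorname{dom}(L)\rightarrow L^2_{\mathbb{X}}$ is self-adjoint, $-L$ is positive and one has $\sigma(L)=\sigma_p(L)\subseteq-\mathbb{N}_0=\{p\in\mathbb{Z}\,:\,p\leq 0\}$. Moreover, the eigenspace of $L$ corresponding to an eigenvalue $-p\in\sigma_p(L)$ is precisely given by the $p$-th Hoeffding space $\mathcal{H}_p$.
   Context: $\mathbb{N}=\{1,2,\ldots\}$, $\mathbb{N}_0=\mathbb{N}\cup\{0\}$. Let $(E_n,\mathcal{B}_n,\mu_n)$, $n\in\mathbb{N}$, be arbitrary probability spaces, and let $\mathbb{X}=(X_n)_{n\in\mathbb{N}}$ be a sequence of independent random variables on a probability space $(\Omega,\mathcal{A},\mathbb{P})$, where $X_n$ takes values in $E_n$ and has distribution $\mu_n$. Let $\mathcal{F}=\sigma(\mathbb{X})$, $\mathbb{P}_{\mathcal{F}}$ the restriction of $\mathbb{P}$ to $\mathcal{F}$, $L^2_{\mathbb{X}}=L^2(\Omega,\mathcal{F},\mathbb{P})$ (real-valued), and let $\kappa$ be the counting measure on $\mathbb{N}$. For $M\subseteq\mathbb{N}$ let $\mathcal{F}_M=\sigma(X_j,j\in M)$ and let $\mathcal{G}_k=\sigma(X_j,j\neq k)$. Infinite Hoeffding decomposition: for $F\in L^2_{\mathbb{X}}$ and finite $M\subseteq\mathbb{N}$ put $F_M:=\sum_{L\subseteq M}(-1)^{|M|-|L|}\mathbb{E}[F\,|\,\mathcal{F}_L]$, and $F^{(p)}:=\sum_{|M|=p}F_M$ for $p\in\mathbb{N}_0$.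 Then $F=\sum_{|M|<\infty}F_M=\sum_{p=0}^\infty F^{(p)}$, where all series converge unconditionally in $L^2(\mathbb{P})$ and have orthogonal summands. The $p$-th Hoeffding space is $\mathcal{H}_p:=\{F\in L^2_{\mathbb{X}}:F=F^{(p)}\}$. Malliavin operators: for $F\in L^2_{\mathbb{X}}$, $D_kF:=F-\mathbb{E}[F\,|\,\mathcal{G}_k]$. On the dense subspace $\mathcal{S}\subseteq L^2_{\mathbb{X}}$ of random variables that are $\sigma(X_1,\dotsc,X_n)$-measurable for some $n$, define $DF:=(D_kF)_{k\in\mathbb{N}}\in L^2(\kappa\otimes\mathbb{P}_{\mathcal{F}})$. This operator is closable; its closure is again denoted by $D$, with domain $\operatorname{dom}(D)\subseteq L^2_{\mathbb{X}}$, and $DF=(D_kF)_{k\in\mathbb{N}}$ for all $F\in\operatorname{dom}(D)$. The divergence $\delta$ is the adjoint of $D$: $\operatorname{dom}(\delta)$ is the set of all $U=(U_k)_{k}\in L^2(\kappa\otimes\mathbb{P}_{\mathcal{F}})$ for which there is $C<\infty$ with $\bigl|\sum_{k=1}^\infty\mathbb{E}[D_kF\,U_k]\bigr|\leq C\|F\|_2$ for all $F\in\operatorname{dom}(D)$, and $\mathbb{E}[F\,\delta U]=\sum_{k=1}^\infty\mathbb{E}[D_kF\,U_k]$ for all such $F$. The Ornstein-Uhlenbeck generator $L$ has domain $\operatorname{dom}(L):=\{F\in\operatorname{dom}(D): DF\in\operatorname{dom}(\delta)\}$ and $LF:=-\delta DF$. Self-adjoint means $L=L^*$ (including equality of domains),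 $L^*$ being the Hilbert space adjoint. Positivity of $-L$ means $\mathbb{E}[F(-LF)]\geq0$ for all $F\in\operatorname{dom}(L)$. The spectrum $\sigma(L)$ is the set of all $\lambda\in\mathbb{R}$ such that $L-\lambda\operatorname{Id}:\operatorname{dom}(L)\to L^2_{\mathbb{X}}$ is not bijective; the point spectrum $\sigma_p(L)$ (set of eigenvalues) is the set of those $\lambda\in\sigma(L)$ for which $L-\lambda\operatorname{Id}$ is not injective; the eigenspace of $\lambda\in\sigma_p(L)$ is $\ker(L-\lambda\operatorname{Id})$. *)

theory Defs
  imports "HOL-Probability.Probability"
begin

text \<open>
  Elements of \<open>L\<^sup>2\<close> are represented by square-integrable functions. Equality in \<open>L\<^sup>2\<close> is
  almost-everywhere equality, so operators, injectivity, surjectivity and kernels are understood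
  modulo null sets. Sets of elements of \<open>L\<^sup>2\<close> (domains, eigenspaces, Hoeffding spaces) contain
  all representatives of their elements and can be compared as sets of functions. The only
  exception is \<open>malliavin_core\<close>, which enters only through a closure.
\<close>

definition L2_space :: "'a measure \<Rightarrow> ('a \<Rightarrow> real) set" where
  "L2_space N = {f \<in> borel_measurable N. integrable N (\<lambda>x. (f x)\<^sup>2)}"

definition L2_norm :: "'a measure \<Rightarrow> ('a \<Rightarrow> real) \<Rightarrow> real" where
  "L2_norm N f = sqrt (\<integral>x. (f x)\<^sup>2 \<partial>N)"

text \<open>Unconditional convergence in \<open>L\<^sup>2\<close>: the net of all finite partial sums converges.\<close>

definition L2_has_sum ::
  "'a measure \<Rightarrow> ('i \<Rightarrow> 'a \<Rightarrow> real) \<Rightarrow> 'i set \<Rightarrow> ('a \<Rightarrow> real) \<Rightarrow> bool" where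
  "L2_has_sum N f I s \<longleftrightarrow> s \<in> L2_space N \<and>
     ((\<lambda>A. L2_norm N (\<lambda>x. (\<Sum>i\<in>A. f i x) - s x)) \<longlongrightarrow> 0) (finite_subsets_at_top I)"


subsection \<open>Unbounded operators on \<open>L\<^sup>2\<close>\<close>

text \<open>An operator on \<open>L2_space N\<close> is given by its domain \<open>A\<close> and its action \<open>T\<close> on \<open>A\<close>.\<close>

definition L2_dense :: "'a measure \<Rightarrow> ('a \<Rightarrow> real) set \<Rightarrow> bool" where
  "L2_dense N A \<longleftrightarrow> A \<subseteq> L2_space N \<and>
     (\<forall>f\<in>L2_space N. \<forall>e>0. \<exists>g\<in>A. L2_norm N (\<lambda>x. f x - g x) < e)"

definition adjoint_dom ::
  "'a measure \<Rightarrow> ('a \<Rightarrow> real) set \<Rightarrow> (('a \<Rightarrow> real) \<Rightarrow> 'a \<Rightarrow> real) \<Rightarrow> ('a \<Rightarrow> real) set" where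
  "adjoint_dom N A T = {g \<in> L2_space N.
     \<exists>C. \<forall>f\<in>A. \<bar>\<integral>x. T f x * g x \<partial>N\<bar> \<le> C * L2_norm N f}"

text \<open>For densely defined operators the choice is unique up to null sets.\<close>

definition adjoint_op ::
  "'a measure \<Rightarrow> ('a \<Rightarrow> real) set \<Rightarrow> (('a \<Rightarrow> real) \<Rightarrow> 'a \<Rightarrow> real) \<Rightarrow> ('a \<Rightarrow> real) \<Rightarrow> 'a \<Rightarrow> real" where
  "adjoint_op N A T g = (SOME h. h \<in> L2_space N \<and>
     (\<forall>f\<in>A. (\<integral>x. T f x * g x \<partial>N) = (\<integral>x. f x * h x \<partial>N)))"

definition L2_self_adjoint ::
  "'a measure \<Rightarrow> ('a \<Rightarrow> real) set \<Rightarrow> (('a \<Rightarrow> real) \<Rightarrow> 'a \<Rightarrow> real) \<Rightarrow> bool" where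
  "L2_self_adjoint N A T \<longleftrightarrow> L2_dense N A \<and> A = adjoint_dom N A T \<and>
     (\<forall>f\<in>A. AE x in N. T f x = adjoint_op N A T f x)"

definition L2_injective ::
  "'a measure \<Rightarrow> ('a \<Rightarrow> real) set \<Rightarrow> (('a \<Rightarrow> real) \<Rightarrow> 'a \<Rightarrow> real) \<Rightarrow> bool" where
  "L2_injective N A T \<longleftrightarrow>
     (\<forall>f\<in>A. \<forall>g\<in>A. (AE x in N. T f x = T g x) \<longrightarrow> (AE x in N. f x = g x))"

definition L2_surjective ::
  "'a measure \<Rightarrow> ('a \<Rightarrow> real) set \<Rightarrow> (('a \<Rightarrow> real) \<Rightarrow> 'a \<Rightarrow> real) \<Rightarrow> bool" where
  "L2_surjective N A T \<longleftrightarrow> (\<forall>h\<in>L2_space N. \<exists>f\<in>A. AE x in N. T f x = h x)"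

definition spectrum ::
  "'a measure \<Rightarrow> ('a \<Rightarrow> real) set \<Rightarrow> (('a \<Rightarrow> real) \<Rightarrow> 'a \<Rightarrow> real) \<Rightarrow> real set" where
  "spectrum N A T = {c. \<not> (L2_injective N A (\<lambda>f x. T f x - c * f x) \<and>
                           L2_surjective N A (\<lambda>f x. T f x - c * f x))}"

definition point_spectrum ::
  "'a measure \<Rightarrow> ('a \<Rightarrow> real) set \<Rightarrow> (('a \<Rightarrow> real) \<Rightarrow> 'a \<Rightarrow> real) \<Rightarrow> real set" where
  "point_spectrum N A T =
     {c \<in> spectrum N A T. \<not> L2_injective N A (\<lambda>f x. T f x - c * f x)}"

definition eigenspace ::
  "'a measure \<Rightarrow> ('a \<Rightarrow> real) set \<Rightarrow> (('a \<Rightarrow> real) \<Rightarrow> 'a \<Rightarrow> real) \<Rightarrow> real \<Rightarrow> ('a \<Rightarrow> real) set" where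
  "eigenspace N A T c = {f \<in> A. AE x in N. T f x - c * f x = 0}"


subsection \<open>Hoeffding spaces\<close>

text \<open>
  In what follows, \<open>X n\<close> is a random variable on \<open>P\<close> with values in \<open>E n\<close>. The index set is
  \<open>{0, 1, 2, \<dots>}\<close> instead of \<open>{1, 2, 3, \<dots>}\<close>, so that \<open>X 0\<close> is the first variable.
  \<open>sigX P E X J\<close> is \<open>\<sigma>(X\<^sub>j, j \<in> J)\<close>; it is trivial for \<open>J = {}\<close>.
\<close>

definition sigX ::
  "'a measure \<Rightarrow> (nat \<Rightarrow> 'e measure) \<Rightarrow> (nat \<Rightarrow> 'a \<Rightarrow> 'e) \<Rightarrow> nat set \<Rightarrow> 'a measure" where
  "sigX P E X J = sigma (space P) (\<Union>j\<in>J. {X j -` B \<inter> space P | B. B \<in> sets (E j)})"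

definition PF :: "'a measure \<Rightarrow> (nat \<Rightarrow> 'e measure) \<Rightarrow> (nat \<Rightarrow> 'a \<Rightarrow> 'e) \<Rightarrow> 'a measure" where
  "PF P E X = restr_to_subalg P (sigX P E X UNIV)"

definition hoeffding_component ::
  "'a measure \<Rightarrow> (nat \<Rightarrow> 'e measure) \<Rightarrow> (nat \<Rightarrow> 'a \<Rightarrow> 'e) \<Rightarrow> ('a \<Rightarrow> real) \<Rightarrow> nat set \<Rightarrow> 'a \<Rightarrow> real" where
  "hoeffding_component P E X F M = (\<lambda>\<omega>. \<Sum>K\<in>Pow M.
     (-1) ^ (card M - card K) * real_cond_exp P (sigX P E X K) F \<omega>)"

definition hoeffding_part ::
  "'a measure \<Rightarrow> (nat \<Rightarrow> 'e measure) \<Rightarrow> (nat \<Rightarrow> 'a \<Rightarrow> 'e) \<Rightarrow> ('a \<Rightarrow> real) \<Rightarrow> nat \<Rightarrow> 'a \<Rightarrow> real" where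
  "hoeffding_part P E X F p = (SOME G. L2_has_sum (PF P E X)
     (hoeffding_component P E X F) {M. finite M \<and> card M = p} G)"

definition hoeffding_space ::
  "'a measure \<Rightarrow> (nat \<Rightarrow> 'e measure) \<Rightarrow> (nat \<Rightarrow> 'a \<Rightarrow> 'e) \<Rightarrow> nat \<Rightarrow> ('a \<Rightarrow> real) set" where
  "hoeffding_space P E X p = {F \<in> L2_space (PF P E X).
     AE \<omega> in PF P E X. F \<omega> = hoeffding_part P E X F p \<omega>}"


subsection \<open>Malliavin operators\<close>

definition kappa_PF ::
  "'a measure \<Rightarrow> (nat \<Rightarrow> 'e measure) \<Rightarrow> (nat \<Rightarrow> 'a \<Rightarrow> 'e) \<Rightarrow> (nat \<times> 'a) measure" where
  "kappa_PF P E X = count_space UNIV \<Otimes>\<^sub>M PF P E X"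

definition malliavin_D ::
  "'a measure \<Rightarrow> (nat \<Rightarrow> 'e measure) \<Rightarrow> (nat \<Rightarrow> 'a \<Rightarrow> 'e) \<Rightarrow> ('a \<Rightarrow> real) \<Rightarrow> nat \<times> 'a \<Rightarrow> real" where
  "malliavin_D P E X F = (\<lambda>(k, \<omega>). F \<omega> - real_cond_exp P (sigX P E X (- {k})) F \<omega>)"

definition malliavin_core ::
  "'a measure \<Rightarrow> (nat \<Rightarrow> 'e measure) \<Rightarrow> (nat \<Rightarrow> 'a \<Rightarrow> 'e) \<Rightarrow> ('a \<Rightarrow> real) set" where
  "malliavin_core P E X =
     {F \<in> L2_space (PF P E X). \<exists>n. F \<in> borel_measurable (sigX P E X {..<n})}"

text \<open>
  The graph of the closure of \<open>D\<close> is the closure of the graph of \<open>D\<close> on the core. The closure acts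
  by the same formula \<open>(D\<^sub>k F)\<^sub>k\<close>, so only its domain needs a new definition.
\<close>

definition malliavin_graph ::
  "'a measure \<Rightarrow> (nat \<Rightarrow> 'e measure) \<Rightarrow> (nat \<Rightarrow> 'a \<Rightarrow> 'e) \<Rightarrow>
     (('a \<Rightarrow> real) \<times> (nat \<times> 'a \<Rightarrow> real)) set" where
  "malliavin_graph P E X = {(F, U). F \<in> L2_space (PF P E X) \<and> U \<in> L2_space (kappa_PF P E X) \<and>
     (\<exists>\<Phi> :: nat \<Rightarrow> 'a \<Rightarrow> real. (\<forall>n. \<Phi> n \<in> malliavin_core P E X) \<and>
        (\<lambda>n. L2_norm (PF P E X) (\<lambda>\<omega>. \<Phi> n \<omega> - F \<omega>)) \<longlonglongrightarrow> 0 \<and>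
        (\<lambda>n. L2_norm (kappa_PF P E X) (\<lambda>z. malliavin_D P E X (\<Phi> n) z - U z)) \<longlonglongrightarrow> 0)}"

definition malliavin_dom ::
  "'a measure \<Rightarrow> (nat \<Rightarrow> 'e measure) \<Rightarrow> (nat \<Rightarrow> 'a \<Rightarrow> 'e) \<Rightarrow> ('a \<Rightarrow> real) set" where
  "malliavin_dom P E X = Domain (malliavin_graph P E X)"

definition divergence_dom ::
  "'a measure \<Rightarrow> (nat \<Rightarrow> 'e measure) \<Rightarrow> (nat \<Rightarrow> 'a \<Rightarrow> 'e) \<Rightarrow> (nat \<times> 'a \<Rightarrow> real) set" where
  "divergence_dom P E X = {U \<in> L2_space (kappa_PF P E X).
     \<exists>C. \<forall>F\<in>malliavin_dom P E X.
       \<bar>\<Sum>k. \<integral>\<omega>. malliavin_D P E X F (k, \<omega>) * U (k, \<omega>) \<partial>P\<bar> \<le> C * L2_norm (PF P E X) F}"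

definition divergence ::
  "'a measure \<Rightarrow> (nat \<Rightarrow> 'e measure) \<Rightarrow> (nat \<Rightarrow> 'a \<Rightarrow> 'e) \<Rightarrow> (nat \<times> 'a \<Rightarrow> real) \<Rightarrow> 'a \<Rightarrow> real" where
  "divergence P E X U = (SOME G. G \<in> L2_space (PF P E X) \<and>
     (\<forall>F\<in>malliavin_dom P E X. (\<integral>\<omega>. F \<omega> * G \<omega> \<partial>P) =
        (\<Sum>k. \<integral>\<omega>. malliavin_D P E X F (k, \<omega>) * U (k, \<omega>) \<partial>P)))"

definition OU_dom ::
  "'a measure \<Rightarrow> (nat \<Rightarrow> 'e measure) \<Rightarrow> (nat \<Rightarrow> 'a \<Rightarrow> 'e) \<Rightarrow> ('a \<Rightarrow> real) set" where
  "OU_dom P E X = {F \<in> malliavin_dom P E X. malliavin_D P E X F \<in> divergence_dom P E X}"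

definition OU_gen ::
  "'a measure \<Rightarrow> (nat \<Rightarrow> 'e measure) \<Rightarrow> (nat \<Rightarrow> 'a \<Rightarrow> 'e) \<Rightarrow> ('a \<Rightarrow> real) \<Rightarrow> 'a \<Rightarrow> real" where
  "OU_gen P E X F = (\<lambda>\<omega>. - divergence P E X (malliavin_D P E X F) \<omega>)"

end

theory Submission
  imports Defs
begin

text \<open>
  The conditional expectations \<open>E[\<cdot> | \<F>\<^sub>J]\<close> are orthogonal projections, and independence
  gives \<open>E[E[F | \<F>\<^sub>K] | \<F>\<^sub>J] = E[F | \<F>\<^bsub>J \<inter> K\<^esub>]\<close>. Hence the maps \<open>F \<mapsto> F\<^sub>M\<close>, \<open>M\<close> finite, are mutually
  orthogonal projections, and by density of the cylinder functions they decompose \<open>L\<^sup>2\<close> completely.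
  Since \<open>(D\<^sub>k F)\<^sub>M\<close> is \<open>F\<^sub>M\<close> if \<open>k \<in> M\<close> and \<open>0\<close> otherwise, \<open>D\<close>, \<open>\<delta>\<close> and \<open>L\<close> become diagonal:
  \<open>dom D\<close> is \<open>{F. \<Sum>\<^sub>M |M| \<parallel>F\<^sub>M\<parallel>\<^sup>2 < \<infinity>}\<close>, \<open>dom L\<close> is \<open>{F. \<Sum>\<^sub>M |M|\<^sup>2 \<parallel>F\<^sub>M\<parallel>\<^sup>2 < \<infinity>}\<close>, and
  \<open>(L F)\<^sub>M = - |M| F\<^sub>M\<close>. All claims then hold for any operator acting by \<open>- d\<^sub>i\<close>, \<open>d\<^sub>i \<in> \<nat>\<close>, on the
  components of an orthogonal decomposition, with maximal domain.
\<close>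

section \<open>The space of square-integrable functions\<close>

text \<open>The integrality of the levels makes the spectrum pure point. For fixed \<open>a\<close>,
  those numbers \<open>d i + a\<close> that do not vanish stay away from 0, so where
  \<open>L - a Id\<close> is injective, its componentwise inverse is bounded and maps into the
  domain. Levels can be empty, for instance when all but finitely many \<open>X k\<close> generate
  only events of probability 0 or 1, so the spectrum can be a proper subset of the non-positive
  integers.

  Two difficulties shape the proof. Elements are functions, and adjoint, divergence and Hoeffding
  parts are picked by \<open>SOME\<close>; each choice is identified up to null sets, by uniqueness
  of limits or by testing against a dense domain. The domain of \<open>D\<close> comes from the
  closure of a graph and is reached only by approximation: in one direction finite partial sums of
  the energy pass to the limit, in the other the conditional expectations given the first
  \<open>n\<close> variables converge in graph norm.\<close>

definition L2_inner :: "'a measure \<Rightarrow> ('a \<Rightarrow> real) \<Rightarrow> ('a \<Rightarrow> real) \<Rightarrow> real" where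
  "L2_inner N f g = (\<integral>x. f x * g x \<partial>N)"

lemma L2_space_measurable [measurable_dest]: "f \<in> L2_space N \<Longrightarrow> f \<in> borel_measurable N"
  by (simp add: L2_space_def)

lemma L2_space_integrable_square: "f \<in> L2_space N \<Longrightarrow> integrable N (\<lambda>x. (f x)\<^sup>2)"
  by (simp add: L2_space_def)

lemma L2_space_mult_integrable:
  assumes "f \<in> L2_space N" "g \<in> L2_space N"
  shows "integrable N (\<lambda>x. f x * g x)"
proof (rule Bochner_Integration.integrable_bound)
  show "integrable N (\<lambda>x. (f x)\<^sup>2 + (g x)\<^sup>2)"
    using assms by (simp add: L2_space_integrable_square)
  show "(\<lambda>x. f x * g x) \<in> borel_measurable N" using assms by measurable
  have "\<bar>f x * g x\<bar> \<le> (f x)\<^sup>2 + (g x)\<^sup>2" for x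
  proof -
    have "0 \<le> (\<bar>f x\<bar> - \<bar>g x\<bar>)\<^sup>2" by simp
    moreover have "0 \<le> \<bar>f x\<bar> * \<bar>g x\<bar>" by simp
    ultimately show ?thesis
      unfolding power2_diff abs_mult power2_abs by linarith
  qed
  then show "AE x in N. norm (f x * g x) \<le> norm ((f x)\<^sup>2 + (g x)\<^sup>2)" by simp
qed

lemma L2_space_add [intro]:
  assumes "f \<in> L2_space N" "g \<in> L2_space N"
  shows "(\<lambda>x. f x + g x) \<in> L2_space N"
proof -
  have "integrable N (\<lambda>x. (f x)\<^sup>2 + (g x)\<^sup>2 + 2 * (f x * g x))"
    using assms by (intro Bochner_Integration.integrable_add integrable_mult_right
        L2_space_mult_integrable L2_space_integrable_square)
  moreover have "(\<lambda>x. (f x + g x)\<^sup>2) = (\<lambda>x. (f x)\<^sup>2 + (g x)\<^sup>2 + 2 * (f x * g x))"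
    by (simp add: power2_sum mult.assoc)
  ultimately show ?thesis using assms by (auto simp: L2_space_def)
qed

lemma L2_space_cmult [intro]: "f \<in> L2_space N \<Longrightarrow> (\<lambda>x. c * f x) \<in> L2_space N"
  by (auto simp: L2_space_def power_mult_distrib)

lemma L2_space_uminus [intro]: "f \<in> L2_space N \<Longrightarrow> (\<lambda>x. - f x) \<in> L2_space N"
  using L2_space_cmult[of f N "-1"] by simp

lemma L2_space_diff [intro]:
  "f \<in> L2_space N \<Longrightarrow> g \<in> L2_space N \<Longrightarrow> (\<lambda>x. f x - g x) \<in> L2_space N"
  using L2_space_add[of f N "\<lambda>x. - g x"] L2_space_uminus[of g N] by simp

lemma L2_space_zero [intro]: "(\<lambda>x. 0) \<in> L2_space N"
  by (simp add: L2_space_def)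

lemma L2_space_sum [intro]:
  "(\<And>i. i \<in> A \<Longrightarrow> f i \<in> L2_space N) \<Longrightarrow> (\<lambda>x. \<Sum>i\<in>A. f i x) \<in> L2_space N"
  by (induction A rule: infinite_finite_induct) (auto intro!: L2_space_zero L2_space_add)

lemma L2_inner_commute: "L2_inner N f g = L2_inner N g f"
  by (simp add: L2_inner_def mult.commute)

lemma L2_inner_add_left:
  "f \<in> L2_space N \<Longrightarrow> g \<in> L2_space N \<Longrightarrow> h \<in> L2_space N \<Longrightarrow>
    L2_inner N (\<lambda>x. f x + g x) h = L2_inner N f h + L2_inner N g h"
  by (simp add: L2_inner_def distrib_right L2_space_mult_integrable)

lemma L2_inner_diff_left:
  "f \<in> L2_space N \<Longrightarrow> g \<in> L2_space N \<Longrightarrow> h \<in> L2_space N \<Longrightarrow>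
    L2_inner N (\<lambda>x. f x - g x) h = L2_inner N f h - L2_inner N g h"
  by (simp add: L2_inner_def left_diff_distrib L2_space_mult_integrable)

lemma L2_inner_cmult_left: "L2_inner N (\<lambda>x. c * f x) g = c * L2_inner N f g"
  by (simp add: L2_inner_def mult.assoc)

lemma L2_inner_sum_left:
  "(\<And>i. i \<in> A \<Longrightarrow> f i \<in> L2_space N) \<Longrightarrow> h \<in> L2_space N \<Longrightarrow>
    L2_inner N (\<lambda>x. \<Sum>i\<in>A. f i x) h = (\<Sum>i\<in>A. L2_inner N (f i) h)"
  by (simp add: L2_inner_def sum_distrib_right Bochner_Integration.integral_sum
      L2_space_mult_integrable)

lemma L2_inner_add_right:
  "f \<in> L2_space N \<Longrightarrow> g \<in> L2_space N \<Longrightarrow> h \<in> L2_space N \<Longrightarrow>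
    L2_inner N h (\<lambda>x. f x + g x) = L2_inner N h f + L2_inner N h g"
  by (simp add: L2_inner_commute[of N h] L2_inner_add_left)

lemma L2_inner_diff_right:
  "f \<in> L2_space N \<Longrightarrow> g \<in> L2_space N \<Longrightarrow> h \<in> L2_space N \<Longrightarrow>
    L2_inner N h (\<lambda>x. f x - g x) = L2_inner N h f - L2_inner N h g"
  by (simp add: L2_inner_commute[of N h] L2_inner_diff_left)

lemma L2_inner_cmult_right: "L2_inner N g (\<lambda>x. c * f x) = c * L2_inner N g f"
  by (simp add: L2_inner_commute[of N g] L2_inner_cmult_left)

lemma L2_inner_sum_right:
  "(\<And>i. i \<in> A \<Longrightarrow> f i \<in> L2_space N) \<Longrightarrow> h \<in> L2_space N \<Longrightarrow>
    L2_inner N h (\<lambda>x. \<Sum>i\<in>A. f i x) = (\<Sum>i\<in>A. L2_inner N h (f i))"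
  by (simp add: L2_inner_commute[of N h] L2_inner_sum_left)

lemma L2_inner_cong_AE:
  assumes "AE x in N. f x = f' x" "AE x in N. g x = g' x"
    and "f \<in> L2_space N" "f' \<in> L2_space N" "g \<in> L2_space N" "g' \<in> L2_space N"
  shows "L2_inner N f g = L2_inner N f' g'"
  unfolding L2_inner_def using assms by (intro integral_cong_AE) auto

lemma L2_norm_nonneg [simp]: "0 \<le> L2_norm N f"
  by (simp add: L2_norm_def)

lemma L2_norm_square: "(L2_norm N f)\<^sup>2 = L2_inner N f f"
  by (simp add: L2_norm_def L2_inner_def power2_eq_square)

lemma L2_inner_self_nonneg [simp]: "0 \<le> L2_inner N f f"
  by (simp flip: L2_norm_square)

lemma L2_norm_cong_AE:
  "AE x in N. f x = f' x \<Longrightarrow> f \<in> L2_space N \<Longrightarrow> f' \<in> L2_space N \<Longrightarrow> L2_norm N f = L2_norm N f'"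
  unfolding L2_norm_def by (intro arg_cong[where f = sqrt] integral_cong_AE) auto

lemma L2_norm_eq_0_iff:
  assumes "f \<in> L2_space N"
  shows "L2_norm N f = 0 \<longleftrightarrow> (AE x in N. f x = 0)"
  using integral_nonneg_eq_0_iff_AE[OF L2_space_integrable_square[OF assms]]
  by (simp add: L2_norm_def)

lemma L2_norm_cmult: "L2_norm N (\<lambda>x. c * f x) = \<bar>c\<bar> * L2_norm N f"
  by (simp add: L2_norm_def power_mult_distrib real_sqrt_mult)

lemma L2_norm_minus_commute: "L2_norm N (\<lambda>x. f x - g x) = L2_norm N (\<lambda>x. g x - f x)"
  by (simp add: L2_norm_def power2_commute)

lemma L2_norm_square_add:
  assumes "f \<in> L2_space N" "g \<in> L2_space N"
  shows "(L2_norm N (\<lambda>x. f x + g x))\<^sup>2 = (L2_norm N f)\<^sup>2 + 2 * L2_inner N f g + (L2_norm N g)\<^sup>2"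
  using assms
  by (simp add: L2_norm_square L2_inner_add_left L2_inner_add_right L2_space_add L2_inner_commute[of N g f])

lemma L2_norm_square_diff:
  assumes "f \<in> L2_space N" "g \<in> L2_space N"
  shows "(L2_norm N (\<lambda>x. f x - g x))\<^sup>2 = (L2_norm N f)\<^sup>2 - 2 * L2_inner N f g + (L2_norm N g)\<^sup>2"
  using assms
  by (simp add: L2_norm_square L2_inner_diff_left L2_inner_diff_right L2_space_diff L2_inner_commute[of N g f])

lemma L2_Cauchy_Schwarz:
  assumes f: "f \<in> L2_space N" and g: "g \<in> L2_space N"
  shows "\<bar>L2_inner N f g\<bar> \<le> L2_norm N f * L2_norm N g"
proof (cases "L2_norm N g = 0")
  case True
  then have "AE x in N. g x = 0" using L2_norm_eq_0_iff[OF g] by simp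
  then have "L2_inner N f g = L2_inner N f (\<lambda>x. 0)"
    using f g by (intro L2_inner_cong_AE) auto
  then show ?thesis using True by (simp add: L2_inner_def)
next
  case False
  define a b c where "a = (L2_norm N f)\<^sup>2" and "b = L2_inner N f g" and "c = (L2_norm N g)\<^sup>2"
  have c: "c > 0" using False by (simp add: c_def)
  \<comment> \<open>\<open>b / c\<close> is the coefficient of the orthogonal projection of
    \<open>f\<close> onto \<open>g\<close>, which minimises this norm.\<close>
  have "0 \<le> (L2_norm N (\<lambda>x. f x - (b / c) * g x))\<^sup>2" by simp
  also have "\<dots> = a - 2 * (b / c) * b + (b / c)\<^sup>2 * c"
    by (simp only: L2_norm_square_diff[OF f L2_space_cmult[OF g]] L2_inner_cmult_right
        L2_norm_cmult power_mult_distrib a_def b_def c_def power2_abs mult.assoc)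
  also have "\<dots> = a - b\<^sup>2 / c" using c by (simp add: field_simps power2_eq_square)
  finally have "b\<^sup>2 \<le> a * c" using c by (simp add: field_simps)
  then have "\<bar>b\<bar>\<^sup>2 \<le> (L2_norm N f * L2_norm N g)\<^sup>2"
    by (simp add: a_def c_def power_mult_distrib)
  then show ?thesis unfolding b_def
    by (rule power2_le_imp_le) simp
qed

lemma L2_norm_triangle:
  assumes f: "f \<in> L2_space N" and g: "g \<in> L2_space N"
  shows "L2_norm N (\<lambda>x. f x + g x) \<le> L2_norm N f + L2_norm N g"
proof (rule power2_le_imp_le)
  show "(L2_norm N (\<lambda>x. f x + g x))\<^sup>2 \<le> (L2_norm N f + L2_norm N g)\<^sup>2"
    using L2_Cauchy_Schwarz[OF f g] by (simp add: L2_norm_square_add[OF f g] power2_sum)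
qed simp

lemma L2_norm_diff_triangle:
  assumes f: "f \<in> L2_space N" and g: "g \<in> L2_space N" and h: "h \<in> L2_space N"
  shows "L2_norm N (\<lambda>x. f x - h x) \<le> L2_norm N (\<lambda>x. f x - g x) + L2_norm N (\<lambda>x. g x - h x)"
  using L2_norm_triangle[OF L2_space_diff[OF f g] L2_space_diff[OF g h]] by simp

lemma L2_norm_diff_eq_0_iff:
  assumes "f \<in> L2_space N" "g \<in> L2_space N"
  shows "L2_norm N (\<lambda>x. f x - g x) = 0 \<longleftrightarrow> (AE x in N. f x = g x)"
  using L2_norm_eq_0_iff[OF L2_space_diff[OF assms]] by simp

lemma L2_inner_tendsto:
  assumes f: "\<And>n. f n \<in> L2_space N" and f': "f' \<in> L2_space N" and g: "g \<in> L2_space N"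
    and lim: "(\<lambda>n. L2_norm N (\<lambda>x. f n x - f' x)) \<longlonglongrightarrow> 0"
  shows "(\<lambda>n. L2_inner N (f n) g) \<longlonglongrightarrow> L2_inner N f' g"
proof -
  have "(\<lambda>n. L2_inner N (f n) g - L2_inner N f' g) \<longlonglongrightarrow> 0"
  proof (rule Lim_null_comparison)
    show "\<forall>\<^sub>F n in sequentially. norm (L2_inner N (f n) g - L2_inner N f' g)
        \<le> L2_norm N (\<lambda>x. f n x - f' x) * L2_norm N g"
      using L2_Cauchy_Schwarz[OF L2_space_diff[OF f f'] g]
      by (auto simp: L2_inner_diff_left f f' g)
    show "(\<lambda>n. L2_norm N (\<lambda>x. f n x - f' x) * L2_norm N g) \<longlonglongrightarrow> 0"
      using tendsto_mult_left_zero[OF lim] .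
  qed
  then show ?thesis by (rule LIM_zero_cancel)
qed

lemma L2_norm_L1:
  assumes "prob_space N" and f: "f \<in> L2_space N"
  shows "integrable N f" "(\<integral>x. \<bar>f x\<bar> \<partial>N) \<le> L2_norm N f"
proof -
  interpret prob_space N by fact
  have one: "(\<lambda>x. 1) \<in> L2_space N" by (simp add: L2_space_def)
  show "integrable N f" using L2_space_mult_integrable[OF f one] by simp
  have "(\<lambda>x. \<bar>f x\<bar>) \<in> L2_space N" using f by (auto simp: L2_space_def)
  from L2_Cauchy_Schwarz[OF this one] show "(\<integral>x. \<bar>f x\<bar> \<partial>N) \<le> L2_norm N f"
    by (simp add: L2_inner_def L2_norm_def prob_space)
qed

lemma nn_integral_square_L2_norm:
  assumes "f \<in> L2_space N"
  shows "(\<integral>\<^sup>+x. ennreal ((f x)\<^sup>2) \<partial>N) = ennreal ((L2_norm N f)\<^sup>2)"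
  using nn_integral_eq_integral[OF L2_space_integrable_square[OF assms]]
  by (simp add: L2_norm_def)

text \<open>Riesz--Fischer: on a probability space an \<open>L\<^sup>2\<close>-Cauchy sequence is \<open>L\<^sup>1\<close>-Cauchy, hence has an
  almost everywhere convergent subsequence; Fatou's lemma turns this into \<open>L\<^sup>2\<close>-convergence.\<close>

lemma L2_complete:
  assumes "prob_space N" and f: "\<And>n. f n \<in> L2_space N"
    and cauchy: "\<And>e. e > 0 \<Longrightarrow> \<exists>n0. \<forall>m\<ge>n0. \<forall>n\<ge>n0. L2_norm N (\<lambda>x. f m x - f n x) < e"
  shows "\<exists>g\<in>L2_space N. (\<lambda>n. L2_norm N (\<lambda>x. f n x - g x)) \<longlonglongrightarrow> 0"
proof -
  interpret prob_space N by fact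
  have [measurable]: "f n \<in> borel_measurable N" for n using f by auto
  have int: "integrable N (f n)" for n using L2_norm_L1(1)[OF \<open>prob_space N\<close> f] .
  have L1: "\<exists>n0. \<forall>i\<ge>n0. \<forall>j\<ge>n0. (LINT x|N. norm (f i x - f j x)) < e" if e: "e > 0" for e :: real
  proof -
    obtain n0 where "\<forall>m\<ge>n0. \<forall>n\<ge>n0. L2_norm N (\<lambda>x. f m x - f n x) < e" using cauchy[OF e] ..
    then show ?thesis
      using L2_norm_L1(2)[OF \<open>prob_space N\<close> L2_space_diff[OF f f]]
      by (intro exI[of _ n0]) (metis (no_types, lifting) le_less_trans real_norm_def Bochner_Integration.integral_cong)
  qed
  obtain r where r: "strict_mono r" "AE x in N. Cauchy (\<lambda>i. f (r i) x)"
    using cauchy_L1_AE_cauchy_subseq[of N f, OF int L1] by blast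
  define g where "g x = lim (\<lambda>i. f (r i) x)" for x
  have [measurable]: "g \<in> borel_measurable N" unfolding g_def by measurable
  have lim: "AE x in N. (\<lambda>i. f (r i) x) \<longlonglongrightarrow> g x"
    using r(2) by eventually_elim (simp add: g_def Cauchy_convergent_iff convergent_LIMSEQ_iff)
  have fatou: "(\<integral>\<^sup>+x. ennreal ((f m x - g x)\<^sup>2) \<partial>N) \<le> ennreal (e\<^sup>2)"
    if e: "e > 0" and n0: "\<forall>m\<ge>n0. \<forall>n\<ge>n0. L2_norm N (\<lambda>x. f m x - f n x) < e" and m: "m \<ge> n0" for e m n0
  proof -
    have "(\<integral>\<^sup>+x. ennreal ((f m x - g x)\<^sup>2) \<partial>N)
        = (\<integral>\<^sup>+x. liminf (\<lambda>i. ennreal ((f m x - f (r i) x)\<^sup>2)) \<partial>N)"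
    proof (rule nn_integral_cong_AE, use lim in eventually_elim)
      case (elim x)
      have "(\<lambda>i. ennreal ((f m x - f (r i) x)\<^sup>2)) \<longlonglongrightarrow> ennreal ((f m x - g x)\<^sup>2)"
        by (intro tendsto_ennrealI tendsto_power tendsto_diff tendsto_const elim)
      then show ?case by (rule lim_imp_Liminf[OF sequentially_bot, symmetric])
    qed
    also have "\<dots> \<le> liminf (\<lambda>i. \<integral>\<^sup>+x. ennreal ((f m x - f (r i) x)\<^sup>2) \<partial>N)"
      by (rule nn_integral_liminf) measurable
    also have "\<dots> \<le> liminf (\<lambda>i::nat. ennreal (e\<^sup>2))"
    proof (rule Liminf_mono)
      show "\<forall>\<^sub>F i in sequentially. (\<integral>\<^sup>+x. ennreal ((f m x - f (r i) x)\<^sup>2) \<partial>N) \<le> ennreal (e\<^sup>2)"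
        using eventually_ge_at_top[of n0]
      proof eventually_elim
        case (elim i)
        then have "r i \<ge> n0" using r(1) by (meson le_trans seq_suble)
        then have "L2_norm N (\<lambda>x. f m x - f (r i) x) \<le> e" using n0 m by (auto intro: less_imp_le)
        then show ?case
          by (simp add: nn_integral_square_L2_norm[OF L2_space_diff[OF f f]] power_mono ennreal_leI)
      qed
    qed
    also have "\<dots> = ennreal (e\<^sup>2)" by (simp add: Liminf_const)
    finally show ?thesis .
  qed
  have diff: "(\<lambda>x. f m x - g x) \<in> L2_space N"
    if e: "e > 0" and n0: "\<forall>m\<ge>n0. \<forall>n\<ge>n0. L2_norm N (\<lambda>x. f m x - f n x) < e" and m: "m \<ge> n0" for e m n0
    unfolding L2_space_def
    using fatou[OF that] by (auto intro!: integrableI_bounded simp: le_less_trans[OF _ ennreal_less_top])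
  obtain n1 where n1: "\<forall>m\<ge>n1. \<forall>n\<ge>n1. L2_norm N (\<lambda>x. f m x - f n x) < 1"
    using cauchy[of 1] by auto
  \<comment> \<open>\<open>g\<close> is recovered as \<open>f n1 - (f n1 - g)\<close>; Fatou's lemma
    controls only the difference.\<close>
  have g: "g \<in> L2_space N"
    using L2_space_diff[OF f[of n1] diff[OF zero_less_one n1 order_refl]] by simp
  moreover have "(\<lambda>n. L2_norm N (\<lambda>x. f n x - g x)) \<longlonglongrightarrow> 0"
  proof (rule LIMSEQ_I)
    fix e :: real assume "e > 0"
    then have e2: "e / 2 > 0" by simp
    obtain n0 where n0: "\<forall>m\<ge>n0. \<forall>n\<ge>n0. L2_norm N (\<lambda>x. f m x - f n x) < e / 2"
      using cauchy[OF e2] ..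
    have "L2_norm N (\<lambda>x. f m x - g x) < e" if "m \<ge> n0" for m
    proof -
      have "ennreal ((L2_norm N (\<lambda>x. f m x - g x))\<^sup>2) \<le> ennreal ((e / 2)\<^sup>2)"
        using fatou[OF e2 n0 that] by (simp add: nn_integral_square_L2_norm[OF diff[OF e2 n0 that]])
      then have "(L2_norm N (\<lambda>x. f m x - g x))\<^sup>2 \<le> (e / 2)\<^sup>2"
        by (simp add: ennreal_le_iff)
      then have "L2_norm N (\<lambda>x. f m x - g x) \<le> e / 2"
        by (rule power2_le_imp_le) (use e2 in simp)
      then show ?thesis using \<open>e > 0\<close> by simp
    qed
    then show "\<exists>no. \<forall>n\<ge>no. norm (L2_norm N (\<lambda>x. f n x - g x) - 0) < e" by auto
  qed
  ultimately show ?thesis by blast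
qed

section \<open>Orthogonal decompositions\<close>

text \<open>Both limits are within small distance of one common partial sum. This identifies, up to
  null sets, the limit that \<open>hoeffding_part\<close> selects by \<open>SOME\<close>.\<close>

lemma L2_has_sum_unique:
  assumes f: "\<And>i. i \<in> I \<Longrightarrow> f i \<in> L2_space N"
    and G: "L2_has_sum N f I G" and H: "L2_has_sum N f I H"
  shows "AE x in N. G x = H x"
proof -
  have GH: "G \<in> L2_space N" "H \<in> L2_space N" using G H by (auto simp: L2_has_sum_def)
  have lim: "((\<lambda>A. L2_norm N (\<lambda>x. (\<Sum>i\<in>A. f i x) - G x) + L2_norm N (\<lambda>x. (\<Sum>i\<in>A. f i x) - H x)) \<longlongrightarrow> 0 + 0)
      (finite_subsets_at_top I)"
    using G H by (intro tendsto_add) (auto simp: L2_has_sum_def)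
  have "L2_norm N (\<lambda>x. G x - H x)
      \<le> L2_norm N (\<lambda>x. (\<Sum>i\<in>A. f i x) - G x) + L2_norm N (\<lambda>x. (\<Sum>i\<in>A. f i x) - H x)"
    if "A \<subseteq> I" for A
    using L2_norm_diff_triangle[OF GH(1) _ GH(2), of "\<lambda>x. \<Sum>i\<in>A. f i x"] f that
    by (subst L2_norm_minus_commute[of N _ G]) (auto intro!: L2_space_sum)
  then have "L2_norm N (\<lambda>x. G x - H x) \<le> 0 + 0"
    by (intro tendsto_lowerbound[OF lim] eventually_finite_subsets_at_top_weakI) auto
  then have "L2_norm N (\<lambda>x. G x - H x) = 0" using L2_norm_nonneg[of N "\<lambda>x. G x - H x"] by linarith
  then show ?thesis by (simp add: L2_norm_diff_eq_0_iff[OF GH])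
qed

text \<open>Symmetry together with \<open>component_component\<close> makes the \<open>c i\<close>
  mutually orthogonal projections, and \<open>parseval\<close> expresses that they exhaust the
  space. Linearity and compatibility with null sets are consequences of symmetry.\<close>

locale L2_orthogonal_decomposition = prob_space N for N :: "'a measure" +
  fixes c :: "'i \<Rightarrow> ('a \<Rightarrow> real) \<Rightarrow> 'a \<Rightarrow> real" and I :: "'i set"
  assumes component_L2: "i \<in> I \<Longrightarrow> F \<in> L2_space N \<Longrightarrow> c i F \<in> L2_space N"
    and component_sym: "i \<in> I \<Longrightarrow> F \<in> L2_space N \<Longrightarrow> G \<in> L2_space N \<Longrightarrow>
      L2_inner N (c i F) G = L2_inner N F (c i G)"
    and component_component: "i \<in> I \<Longrightarrow> j \<in> I \<Longrightarrow> F \<in> L2_space N \<Longrightarrow>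
      AE x in N. c i (c j F) x = (if i = j then c i F x else 0)"
    and parseval: "F \<in> L2_space N \<Longrightarrow>
      ((\<lambda>i. (L2_norm N (c i F))\<^sup>2) has_sum (L2_norm N F)\<^sup>2) I"
begin

lemma AE_eqI_inner:
  assumes f: "f \<in> L2_space N" and g: "g \<in> L2_space N"
    and eq: "\<And>h. h \<in> L2_space N \<Longrightarrow> L2_inner N f h = L2_inner N g h"
  shows "AE x in N. f x = g x"
proof -
  have h: "(\<lambda>x. f x - g x) \<in> L2_space N" using f g ..
  have "(L2_norm N (\<lambda>x. f x - g x))\<^sup>2 = 0"
    unfolding L2_norm_square by (simp add: L2_inner_diff_left[OF f g h] eq[OF h])
  then show ?thesis by (simp add: L2_norm_diff_eq_0_iff[OF f g])
qed

text \<open>Symmetry moves \<open>c i\<close> onto the test function, where the inner product is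
  linear and blind to null sets. The next lemmas obtain linearity of \<open>c i\<close> in the same
  way.\<close>

lemma component_cong:
  assumes i: "i \<in> I" and F: "F \<in> L2_space N" and G: "G \<in> L2_space N" and eq: "AE x in N. F x = G x"
  shows "AE x in N. c i F x = c i G x"
proof (rule AE_eqI_inner)
  fix h assume h: "h \<in> L2_space N"
  then show "L2_inner N (c i F) h = L2_inner N (c i G) h"
    using L2_inner_cong_AE[OF eq _ F G, of "c i h" "c i h"]
    by (simp add: component_sym component_L2 i F G)
qed (use assms component_L2 in auto)

lemma component_diff:
  assumes i: "i \<in> I" and F: "F \<in> L2_space N" and G: "G \<in> L2_space N"
  shows "AE x in N. c i (\<lambda>x. F x - G x) x = c i F x - c i G x"
  using assms
  by (intro AE_eqI_inner)
     (auto simp: L2_space_diff component_sym component_L2 L2_inner_diff_left)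

lemma component_add:
  assumes i: "i \<in> I" and F: "F \<in> L2_space N" and G: "G \<in> L2_space N"
  shows "AE x in N. c i (\<lambda>x. F x + G x) x = c i F x + c i G x"
  using assms
  by (intro AE_eqI_inner)
     (auto simp: L2_space_add component_sym component_L2 L2_inner_add_left)

lemma component_cmult:
  assumes i: "i \<in> I" and F: "F \<in> L2_space N"
  shows "AE x in N. c i (\<lambda>x. a * F x) x = a * c i F x"
  using assms
  by (intro AE_eqI_inner)
     (auto simp: L2_space_cmult component_sym component_L2 L2_inner_cmult_left)

lemma component_sum:
  assumes i: "i \<in> I" and F: "\<And>k. k \<in> A \<Longrightarrow> F k \<in> L2_space N"
  shows "AE x in N. c i (\<lambda>x. \<Sum>k\<in>A. F k x) x = (\<Sum>k\<in>A. c i (F k) x)"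
  using assms
  by (intro AE_eqI_inner)
     (auto simp: L2_space_sum component_sym component_L2 L2_inner_sum_left)

lemma norm_component_le:
  assumes "i \<in> I" "F \<in> L2_space N"
  shows "L2_norm N (c i F) \<le> L2_norm N F"
  using finite_sum_le_has_sum[OF parseval[OF assms(2)], of "{i}"] assms(1)
  by (auto intro: power2_le_imp_le)

text \<open>Parseval for the difference \<open>F - G\<close>: all its components vanish, hence so
  does its norm.\<close>

lemma AE_eqI_components:
  assumes F: "F \<in> L2_space N" and G: "G \<in> L2_space N"
    and eq: "\<And>i. i \<in> I \<Longrightarrow> AE x in N. c i F x = c i G x"
  shows "AE x in N. F x = G x"
proof -
  have FG: "(\<lambda>x. F x - G x) \<in> L2_space N" using F G ..
  have zero: "(L2_norm N (c i (\<lambda>x. F x - G x)))\<^sup>2 = 0" if "i \<in> I" for i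
  proof -
    have "AE x in N. c i (\<lambda>x. F x - G x) x = 0"
      using component_diff[OF that F G] eq[OF that] by eventually_elim simp
    then show ?thesis by (simp add: L2_norm_eq_0_iff component_L2[OF that FG])
  qed
  have "((\<lambda>i. 0) has_sum (L2_norm N (\<lambda>x. F x - G x))\<^sup>2) I"
    using parseval[OF FG] by (subst has_sum_cong[of _ _ "\<lambda>i. (L2_norm N (c i (\<lambda>x. F x - G x)))\<^sup>2"]) (auto simp: zero)
  then have "(L2_norm N (\<lambda>x. F x - G x))\<^sup>2 = 0"
    using has_sum_unique has_sum_0_simp by blast
  then show ?thesis by (simp add: L2_norm_diff_eq_0_iff[OF F G])
qed

lemma inner_component:
  assumes i: "i \<in> I" and F: "F \<in> L2_space N" and G: "G \<in> L2_space N"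
  shows "L2_inner N (c i F) (c i G) = L2_inner N (c i F) G"
proof -
  have "L2_inner N (c i F) (c i G) = L2_inner N (c i (c i F)) G"
    using assms by (simp add: component_sym component_L2)
  also have "\<dots> = L2_inner N (c i F) G"
    using component_component[OF i i F] by (intro L2_inner_cong_AE) (auto simp: component_L2 assms)
  finally show ?thesis .
qed

text \<open>Polarisation of Parseval's identity.\<close>

lemma inner_has_sum:
  assumes F: "F \<in> L2_space N" and G: "G \<in> L2_space N"
  shows "((\<lambda>i. L2_inner N (c i F) (c i G)) has_sum L2_inner N F G) I"
proof -
  have FG: "(\<lambda>x. F x + G x) \<in> L2_space N" using F G ..
  have "(L2_norm N (c i (\<lambda>x. F x + G x)))\<^sup>2
      = (L2_norm N (c i F))\<^sup>2 + 2 * L2_inner N (c i F) (c i G) + (L2_norm N (c i G))\<^sup>2" if i: "i \<in> I" for i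
  proof -
    have "L2_norm N (c i (\<lambda>x. F x + G x)) = L2_norm N (\<lambda>x. c i F x + c i G x)"
      using component_add[OF i F G] i F G FG
      by (intro L2_norm_cong_AE) (auto simp: component_L2 L2_space_add)
    then show ?thesis by (simp add: L2_norm_square_add component_L2 i F G)
  qed
  then have comp: "1 / 2 * ((L2_norm N (c i (\<lambda>x. F x + G x)))\<^sup>2 + - (L2_norm N (c i F))\<^sup>2 + - (L2_norm N (c i G))\<^sup>2)
      = L2_inner N (c i F) (c i G)" if i: "i \<in> I" for i
    using that by simp
  have "((\<lambda>i. 1 / 2 * ((L2_norm N (c i (\<lambda>x. F x + G x)))\<^sup>2 + - (L2_norm N (c i F))\<^sup>2 + - (L2_norm N (c i G))\<^sup>2))
      has_sum 1 / 2 * ((L2_norm N (\<lambda>x. F x + G x))\<^sup>2 + - (L2_norm N F)\<^sup>2 + - (L2_norm N G)\<^sup>2)) I"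
    by (intro has_sum_cmult_right has_sum_add has_sum_uminusI parseval F G FG)
  also have "1 / 2 * ((L2_norm N (\<lambda>x. F x + G x))\<^sup>2 + - (L2_norm N F)\<^sup>2 + - (L2_norm N G)\<^sup>2) = L2_inner N F G"
    by (simp add: L2_norm_square_add[OF F G])
  finally show ?thesis
    by (subst (asm) has_sum_cong[OF comp])
qed

lemma component_combination:
  assumes A: "A \<subseteq> I" "finite A" and F: "F \<in> L2_space N" and i: "i \<in> I"
  shows "AE x in N. c i (\<lambda>x. \<Sum>j\<in>A. b j * c j F x) x = (if i \<in> A then b i else 0) * c i F x"
proof -
  have bF: "(\<lambda>x. b j * c j F x) \<in> L2_space N" if "j \<in> A" for j
    using that A F by (auto simp: component_L2 L2_space_cmult)
  have "AE x in N. c i (\<lambda>x. b j * c j F x) x = b j * (if i = j then c i F x else 0)" if "j \<in> A" for j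
    using component_cmult[OF i component_L2[OF _ F], of j "b j"] component_component[OF i _ F, of j] that A
    by fastforce
  then have "AE x in N. \<forall>j\<in>A. c i (\<lambda>x. b j * c j F x) x = b j * (if i = j then c i F x else 0)"
    using A by (simp add: AE_finite_all)
  with component_sum[OF i bF, of A id, simplified] show ?thesis
  proof eventually_elim
    case (elim x)
    have "(\<Sum>j\<in>A. c i (\<lambda>x. b j * c j F x) x) = (\<Sum>j\<in>A. if i = j then b j * c i F x else 0)"
      using elim(2) by (intro sum.cong) auto
    then show ?case using elim(1) A by (auto simp: sum.delta)
  qed
qed

lemma combination_L2:
  assumes "A \<subseteq> I" "F \<in> L2_space N"
  shows "(\<lambda>x. \<Sum>j\<in>A. b j * c j F x) \<in> L2_space N"
  using assms by (intro L2_space_sum L2_space_cmult component_L2) auto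

lemma norm_component_combination:
  assumes A: "A \<subseteq> I" "finite A" and F: "F \<in> L2_space N" and i: "i \<in> I"
  shows "L2_norm N (c i (\<lambda>x. \<Sum>j\<in>A. b j * c j F x)) = (if i \<in> A then \<bar>b i\<bar> else 0) * L2_norm N (c i F)"
proof -
  have "L2_norm N (c i (\<lambda>x. \<Sum>j\<in>A. b j * c j F x)) = L2_norm N (\<lambda>x. (if i \<in> A then b i else 0) * c i F x)"
    by (rule L2_norm_cong_AE[OF component_combination[OF assms]])
       (intro component_L2 combination_L2 L2_space_cmult A F i)+
  then show ?thesis by (simp only: L2_norm_cmult) auto
qed

lemma norm_combination:
  assumes A: "A \<subseteq> I" "finite A" and F: "F \<in> L2_space N"
  shows "(L2_norm N (\<lambda>x. \<Sum>j\<in>A. b j * c j F x))\<^sup>2 = (\<Sum>j\<in>A. (b j)\<^sup>2 * (L2_norm N (c j F))\<^sup>2)"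
proof -
  have "((\<lambda>i. (L2_norm N (c i (\<lambda>x. \<Sum>j\<in>A. b j * c j F x)))\<^sup>2) has_sum
      (\<Sum>j\<in>A. (b j)\<^sup>2 * (L2_norm N (c j F))\<^sup>2)) I"
    using A by (intro has_sum_finite_neutralI[of A])
       (auto simp: norm_component_combination[OF A F] power_mult_distrib intro!: sum.cong)
  from has_sum_unique[OF parseval[OF combination_L2[OF A(1) F]] this] show ?thesis .
qed

lemma inner_combination:
  assumes A: "A \<subseteq> I" "finite A" and F: "F \<in> L2_space N" and G: "G \<in> L2_space N"
  shows "L2_inner N (\<lambda>x. \<Sum>j\<in>A. b j * c j F x) G = (\<Sum>j\<in>A. b j * L2_inner N (c j F) (c j G))"
proof -
  have "L2_inner N (\<lambda>x. \<Sum>j\<in>A. b j * c j F x) G = (\<Sum>j\<in>A. L2_inner N (\<lambda>x. b j * c j F x) G)"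
    using A F G by (intro L2_inner_sum_left L2_space_cmult component_L2) auto
  also have "\<dots> = (\<Sum>j\<in>A. b j * L2_inner N (c j F) (c j G))"
    using A F G by (intro sum.cong) (auto simp: L2_inner_cmult_left inner_component)
  finally show ?thesis .
qed

text \<open>The weight multiplies the squared norm, so this is the maximal domain of the multiplier
  \<open>sqrt (w i)\<close>. With \<open>card\<close> as weight it becomes the domain of
  \<open>D\<close>, with its square the domain of \<open>L\<close>; bounded weights give the whole
  space.\<close>

definition weight_dom :: "('i \<Rightarrow> real) \<Rightarrow> ('a \<Rightarrow> real) set" where
  "weight_dom w = {F \<in> L2_space N. (\<lambda>i. w i * (L2_norm N (c i F))\<^sup>2) summable_on I}"

lemma weight_domD: "F \<in> weight_dom w \<Longrightarrow> F \<in> L2_space N"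
  by (simp add: weight_dom_def)

lemma weight_dom_bounded:
  assumes F: "F \<in> L2_space N" and w: "\<And>i. i \<in> I \<Longrightarrow> 0 \<le> w i" "\<And>i. i \<in> I \<Longrightarrow> w i \<le> B"
  shows "F \<in> weight_dom w"
proof -
  have "(\<lambda>i. w i * (L2_norm N (c i F))\<^sup>2) summable_on I"
  proof (rule summable_on_comparison_test)
    show "(\<lambda>i. B * (L2_norm N (c i F))\<^sup>2) summable_on I"
      using parseval[OF F] by (intro summable_on_cmult_right) (auto simp: summable_on_def)
  qed (use w in \<open>auto intro: mult_right_mono\<close>)
  then show ?thesis using F by (simp add: weight_dom_def)
qed

lemma combination_weight_dom:
  assumes A: "A \<subseteq> I" "finite A" and F: "F \<in> L2_space N"
  shows "(\<lambda>x. \<Sum>j\<in>A. b j * c j F x) \<in> weight_dom w"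
proof -
  have "((\<lambda>i. w i * (L2_norm N (c i (\<lambda>x. \<Sum>j\<in>A. b j * c j F x)))\<^sup>2) has_sum
      (\<Sum>j\<in>A. w j * (\<bar>b j\<bar> * L2_norm N (c j F))\<^sup>2)) I"
    using A by (intro has_sum_finite_neutralI[of A])
       (auto simp: norm_component_combination[OF A F] intro!: sum.cong)
  then show ?thesis using combination_L2[OF A(1) F] by (auto simp: weight_dom_def summable_on_def)
qed

lemma component_weight_dom:
  assumes "i \<in> I" "F \<in> L2_space N"
  shows "c i F \<in> weight_dom w"
  using combination_weight_dom[of "{i}" F "\<lambda>_. 1" w] assms by simp

text \<open>The partial sum equals \<open>s\<^sup>2\<close>, where \<open>s\<close> is the norm of
  the truncated multiplier image, so the hypothesis reads \<open>s\<^sup>2 \<le> C * s\<close> and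
  yields \<open>s \<le> \<bar>C\<bar>\<close> uniformly in the truncation. This is how a bounded
  functional forces membership in the domain, both for the adjoint of \<open>T\<close> and for the
  divergence.\<close>

lemma weight_domI_bounded_functional:
  assumes F: "F \<in> L2_space N"
    and bound: "\<And>A. finite A \<Longrightarrow> A \<subseteq> I \<Longrightarrow>
      (\<Sum>i\<in>A. (w i)\<^sup>2 * (L2_norm N (c i F))\<^sup>2) \<le> C * L2_norm N (\<lambda>x. \<Sum>i\<in>A. w i * c i F x)"
  shows "F \<in> weight_dom (\<lambda>i. (w i)\<^sup>2)"
proof -
  have "(\<Sum>i\<in>A. (w i)\<^sup>2 * (L2_norm N (c i F))\<^sup>2) \<le> C\<^sup>2" if A: "finite A" "A \<subseteq> I" for A
  proof -
    define s where "s = L2_norm N (\<lambda>x. \<Sum>i\<in>A. w i * c i F x)"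
    have s: "s\<^sup>2 = (\<Sum>i\<in>A. (w i)\<^sup>2 * (L2_norm N (c i F))\<^sup>2)"
      using norm_combination[OF A(2,1) F] by (simp add: s_def)
    have "s * s \<le> C * s" using bound[OF A] by (simp add: s_def flip: s power2_eq_square)
    moreover have "0 \<le> s" by (simp add: s_def)
    ultimately have "s \<le> \<bar>C\<bar>" by (cases "s = 0") auto
    then have "s\<^sup>2 \<le> \<bar>C\<bar>\<^sup>2" using \<open>0 \<le> s\<close> by (rule power_mono)
    then show ?thesis by (simp add: s)
  qed
  then have "(\<lambda>i. (w i)\<^sup>2 * (L2_norm N (c i F))\<^sup>2) summable_on I"
    by (intro nonneg_bounded_partial_sums_imp_summable_on[of _ _ "C\<^sup>2"]
        eventually_finite_subsets_at_top_weakI) auto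
  then show ?thesis using F by (simp add: weight_dom_def)
qed

text \<open>Finite sets \<open>A n\<close> that capture the weighted sum up to
  \<open>1 / (n + 1)\<close> turn the net of partial sums into a Cauchy sequence, even for an
  uncountable \<open>I\<close>. The sets \<open>A n\<close> are neither nested nor
  exhausting.\<close>

lemma multiplier_exists:
  assumes F: "F \<in> weight_dom (\<lambda>i. (w i)\<^sup>2)"
  shows "\<exists>G\<in>L2_space N. \<forall>i\<in>I. AE x in N. c i G x = w i * c i F x"
proof -
  have F': "F \<in> L2_space N" using F by (rule weight_domD)
  define a where "a i = (w i)\<^sup>2 * (L2_norm N (c i F))\<^sup>2" for i
  define s where "s = infsum a I"
  have a: "(a has_sum s) I" and a_nonneg: "a i \<ge> 0" for i
    using F by (auto simp: weight_dom_def s_def a_def[abs_def])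
  have "\<exists>A. finite A \<and> A \<subseteq> I \<and> s - sum a A < 1 / real (Suc n)" for n
  proof -
    have "\<forall>\<^sub>F A in finite_subsets_at_top I. dist (sum a A) s < 1 / real (Suc n)"
      using a unfolding has_sum_def by (rule tendstoD) simp
    then show ?thesis unfolding eventually_finite_subsets_at_top
      by (metis dist_commute dist_real_def abs_less_iff order_refl)
  qed
  then obtain A where A: "finite (A n)" "A n \<subseteq> I" "s - sum a (A n) < 1 / real (Suc n)" for n
    by metis
  define S where "S n = (\<lambda>x. \<Sum>i\<in>A n. w i * c i F x)" for n
  have S: "S n \<in> L2_space N" for n unfolding S_def using A F' by (intro combination_L2) auto
  \<comment> \<open>Adjoining \<open>B\<close> to \<open>A n\<close> cannot push the partial sum
    above the total \<open>s\<close>.\<close>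
  have tail: "sum a B \<le> 1 / real (Suc n)" if B: "finite B" "B \<subseteq> I" "B \<inter> A n = {}" for B n
  proof -
    have "sum a (A n) + sum a B = sum a (A n \<union> B)"
      using A B by (intro sum.union_disjoint[symmetric]) auto
    also have "\<dots> \<le> s" using A B a_nonneg by (intro finite_sum_le_has_sum[OF a]) auto
    finally show ?thesis using A(3)[of n] by linarith
  qed
  have S_diff: "(L2_norm N (\<lambda>x. S m x - S n x))\<^sup>2 \<le> 1 / real (Suc m) + 1 / real (Suc n)" for m n
  proof -
    \<comment> \<open>The bracket is 1 on \<open>A m - A n\<close>, -1 on \<open>A n - A m\<close>
      and 0 on the common part, so only the two tails survive.\<close>
    define b where "b i = ((if i \<in> A m then 1 else 0) - (if i \<in> A n then 1 else 0)) * w i" for i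
    have "(\<lambda>x. S m x - S n x) = (\<lambda>x. \<Sum>i\<in>A m \<union> A n. b i * c i F x)"
    proof
      fix x
      have "S m x = (\<Sum>i\<in>A m \<union> A n. if i \<in> A m then w i * c i F x else 0)"
        and "S n x = (\<Sum>i\<in>A m \<union> A n. if i \<in> A n then w i * c i F x else 0)"
        unfolding S_def using A by (auto intro!: sum.mono_neutral_cong_left)
      then show "S m x - S n x = (\<Sum>i\<in>A m \<union> A n. b i * c i F x)"
        by (simp add: b_def flip: sum_subtractf) (auto intro!: sum.cong)
    qed
    then have "(L2_norm N (\<lambda>x. S m x - S n x))\<^sup>2 = (\<Sum>i\<in>A m \<union> A n. (b i)\<^sup>2 * (L2_norm N (c i F))\<^sup>2)"
      using A F' by (simp add: norm_combination)
    also have "\<dots> = (\<Sum>i\<in>(A n - A m) \<union> (A m - A n). a i)"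
      using A by (intro sum.mono_neutral_cong_right) (auto simp: b_def a_def)
    also have "\<dots> = sum a (A n - A m) + sum a (A m - A n)"
      using A by (intro sum.union_disjoint) auto
    also have "\<dots> \<le> 1 / real (Suc m) + 1 / real (Suc n)"
      using A by (intro add_mono tail) auto
    finally show ?thesis .
  qed
  have "\<exists>G\<in>L2_space N. (\<lambda>n. L2_norm N (\<lambda>x. S n x - G x)) \<longlonglongrightarrow> 0"
  proof (rule L2_complete[OF prob_space_axioms S])
    fix e :: real assume e: "e > 0"
    then obtain n0 where n0: "1 / real (Suc n0) < e\<^sup>2 / 2"
      using nat_approx_posE[of "e\<^sup>2 / 2"] by auto
    have "L2_norm N (\<lambda>x. S m x - S n x) < e" if "m \<ge> n0" "n \<ge> n0" for m n
    proof (rule power2_less_imp_less)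
      have "1 / real (Suc m) \<le> 1 / real (Suc n0)" "1 / real (Suc n) \<le> 1 / real (Suc n0)"
        using that by (auto intro!: divide_left_mono)
      then show "(L2_norm N (\<lambda>x. S m x - S n x))\<^sup>2 < e\<^sup>2" using S_diff[of m n] n0 by linarith
    qed (use e in simp)
    then show "\<exists>n0. \<forall>m\<ge>n0. \<forall>n\<ge>n0. L2_norm N (\<lambda>x. S m x - S n x) < e" by blast
  qed
  then obtain G where G: "G \<in> L2_space N" and lim: "(\<lambda>n. L2_norm N (\<lambda>x. S n x - G x)) \<longlonglongrightarrow> 0"
    by blast
  have "AE x in N. c i G x = w i * c i F x" if i: "i \<in> I" for i
  proof (rule AE_eqI_inner)
    fix h assume h: "h \<in> L2_space N"
    have "(\<lambda>n. L2_inner N (S n) (c i h)) \<longlonglongrightarrow> L2_inner N G (c i h)"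
      by (rule L2_inner_tendsto[OF S G component_L2[OF i h] lim])
    \<comment> \<open>An index with \<open>a i = 0\<close> may lie in no \<open>A n\<close> at all,
      but then both sides vanish. Otherwise the tail bound forces \<open>i\<close> into
      \<open>A n\<close> as soon as \<open>1 / (n + 1) < a i\<close>.\<close>
    moreover have "(\<lambda>n. L2_inner N (S n) (c i h)) \<longlonglongrightarrow> L2_inner N (\<lambda>x. w i * c i F x) h"
    proof (cases "a i = 0")
      case True
      have "L2_inner N (S n) (c i h) = 0" and "L2_inner N (\<lambda>x. w i * c i F x) h = 0" for n
      proof -
        have z: "AE x in N. w i * c i F x = 0"
          using True L2_norm_eq_0_iff[OF component_L2[OF i F']] by (cases "w i = 0") (auto simp: a_def)
        then have "L2_inner N (\<lambda>x. w i * c i F x) h = L2_inner N (\<lambda>x. 0) h"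
          by (intro L2_inner_cong_AE) (auto intro: h component_L2 i F' L2_space_cmult)
        then show "L2_inner N (\<lambda>x. w i * c i F x) h = 0" by (simp add: L2_inner_def)
        have "AE x in N. c i (S n) x = 0"
          using component_combination[OF A(2)[of n] A(1)[of n] F' i, of w] z by (auto simp: S_def elim!: eventually_elim2)
        then have "L2_inner N (c i (S n)) h = L2_inner N (\<lambda>x. 0) h"
          by (intro L2_inner_cong_AE) (auto intro: h component_L2 i S)
        then show "L2_inner N (S n) (c i h) = 0"
          by (simp add: L2_inner_def component_sym[OF i S h, unfolded L2_inner_def])
      qed
      then show ?thesis by simp
    next
      case False
      then have "a i > 0" using a_nonneg[of i] by linarith
      then obtain n0 where n0: "1 / real (Suc n0) < a i" using nat_approx_posE by blast
      have "L2_inner N (S n) (c i h) = L2_inner N (\<lambda>x. w i * c i F x) h" if "n \<ge> n0" for n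
      proof -
        have "1 / real (Suc n) \<le> 1 / real (Suc n0)" using that by (auto intro!: divide_left_mono)
        then have "i \<in> A n" using tail[of "{i}" n] n0 i by auto
        then have "AE x in N. c i (S n) x = w i * c i F x"
          using component_combination[OF A(2)[of n] A(1)[of n] F' i, of w] by (simp add: S_def)
        then have "L2_inner N (c i (S n)) h = L2_inner N (\<lambda>x. w i * c i F x) h"
          by (intro L2_inner_cong_AE) (auto intro: h component_L2 i S F' L2_space_cmult)
        then show ?thesis by (simp add: component_sym[OF i S h])
      qed
      then show ?thesis by (intro tendsto_eventually) (auto simp: eventually_at_top_linorder)
    qed
    ultimately have "L2_inner N G (c i h) = L2_inner N (\<lambda>x. w i * c i F x) h"
      by (rule LIMSEQ_unique)
    then show "L2_inner N (c i G) h = L2_inner N (\<lambda>x. w i * c i F x) h"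
      by (simp add: component_sym[OF i G h])
  qed (auto intro: component_L2 i G F' L2_space_cmult)
  then show ?thesis using G by blast
qed

lemma multiplier_inner_has_sum:
  assumes F: "F \<in> L2_space N" and G: "G \<in> L2_space N" and h: "h \<in> L2_space N"
    and mult: "\<And>i. i \<in> I \<Longrightarrow> AE x in N. c i G x = w i * c i F x"
  shows "((\<lambda>i. w i * L2_inner N (c i F) (c i h)) has_sum L2_inner N G h) I"
proof -
  have "L2_inner N (c i G) (c i h) = w i * L2_inner N (c i F) (c i h)" if i: "i \<in> I" for i
    using L2_inner_cong_AE[OF mult[OF i], of "c i h" "c i h"]
    by (simp add: component_L2 L2_space_cmult i F G h L2_inner_cmult_left)
  then show ?thesis using inner_has_sum[OF G h] by (simp cong: has_sum_cong)
qed

text \<open>By Pythagoras the squared distance of a partial sum to \<open>G\<close> is the squared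
  norm of \<open>G\<close> minus the partial Parseval sum, so Parseval's convergence is
  unconditional convergence in the mean. It is applied to all of \<open>I\<close> for density and to
  a single level for the Hoeffding parts.\<close>

lemma components_has_sum:
  assumes F: "F \<in> L2_space N" and G: "G \<in> L2_space N" and J: "J \<subseteq> I"
    and comp: "\<And>i. i \<in> I \<Longrightarrow> AE x in N. c i G x = (if i \<in> J then 1 else 0) * c i F x"
  shows "L2_has_sum N (\<lambda>i. c i F) J G"
proof -
  have norm: "(L2_norm N (c i G))\<^sup>2 = (if i \<in> J then (L2_norm N (c i F))\<^sup>2 else 0)" if i: "i \<in> I" for i
    using L2_norm_cong_AE[OF comp[OF i] component_L2[OF i G] L2_space_cmult[OF component_L2[OF i F]]]
    by (auto simp: L2_norm_cmult)
  have sum: "((\<lambda>i. (L2_norm N (c i F))\<^sup>2) has_sum (L2_norm N G)\<^sup>2) J"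
    by (rule has_sum_cong_neutral[THEN iffD1, OF _ _ _ parseval[OF G]]) (use J norm in auto)
  have diff: "L2_norm N (\<lambda>x. (\<Sum>i\<in>A. c i F x) - G x) = sqrt ((L2_norm N G)\<^sup>2 - (\<Sum>i\<in>A. (L2_norm N (c i F))\<^sup>2))"
    if A: "finite A" "A \<subseteq> J" for A
  proof -
    have A': "A \<subseteq> I" using A J by auto
    let ?S = "\<lambda>x. \<Sum>i\<in>A. c i F x"
    have S: "?S \<in> L2_space N" using combination_L2[OF A' F, of "\<lambda>_. 1"] by simp
    have "L2_inner N ?S G = (\<Sum>i\<in>A. L2_inner N (c i F) (c i G))"
      using inner_combination[OF A' A(1) F G, of "\<lambda>_. 1"] by simp
    also have "\<dots> = (\<Sum>i\<in>A. (L2_norm N (c i F))\<^sup>2)"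
    proof (rule sum.cong)
      fix i assume "i \<in> A"
      then have i: "i \<in> I" "i \<in> J" using A J by auto
      show "L2_inner N (c i F) (c i G) = (L2_norm N (c i F))\<^sup>2" unfolding L2_norm_square
        using comp[OF i(1)] i by (intro L2_inner_cong_AE) (auto simp: component_L2 F G)
    qed simp
    finally have "(L2_norm N (\<lambda>x. ?S x - G x))\<^sup>2 = (L2_norm N G)\<^sup>2 - (\<Sum>i\<in>A. (L2_norm N (c i F))\<^sup>2)"
      using norm_combination[OF A' A(1) F, of "\<lambda>_. 1"] by (simp add: L2_norm_square_diff[OF S G])
    then show ?thesis by (metis L2_norm_nonneg real_sqrt_unique)
  qed
  have "((\<lambda>A. sqrt ((L2_norm N G)\<^sup>2 - (\<Sum>i\<in>A. (L2_norm N (c i F))\<^sup>2))) \<longlongrightarrow> sqrt ((L2_norm N G)\<^sup>2 - (L2_norm N G)\<^sup>2))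
      (finite_subsets_at_top J)"
    using sum unfolding has_sum_def by (intro tendsto_real_sqrt tendsto_diff tendsto_const)
  moreover have "\<forall>\<^sub>F A in finite_subsets_at_top J. sqrt ((L2_norm N G)\<^sup>2 - (\<Sum>i\<in>A. (L2_norm N (c i F))\<^sup>2))
      = L2_norm N (\<lambda>x. (\<Sum>i\<in>A. c i F x) - G x)"
    by (intro eventually_finite_subsets_at_top_weakI) (simp add: diff)
  ultimately have "((\<lambda>A. L2_norm N (\<lambda>x. (\<Sum>i\<in>A. c i F x) - G x)) \<longlongrightarrow> 0) (finite_subsets_at_top J)"
    using Lim_transform_eventually by fastforce
  then show ?thesis using G by (simp add: L2_has_sum_def)
qed

text \<open>Finite sums of components lie in every weight domain.\<close>

lemma weight_dom_dense: "L2_dense N (weight_dom w)"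
  unfolding L2_dense_def
proof (intro conjI ballI allI impI subsetI)
  fix F and e :: real assume F: "F \<in> L2_space N" and e: "e > 0"
  have "L2_has_sum N (\<lambda>i. c i F) I F" by (rule components_has_sum[OF F F]) auto
  then have "\<forall>\<^sub>F A in finite_subsets_at_top I. dist (L2_norm N (\<lambda>x. (\<Sum>i\<in>A. c i F x) - F x)) 0 < e"
    unfolding L2_has_sum_def using e by (blast dest: tendstoD)
  then obtain A where A: "A \<subseteq> I" "finite A" "L2_norm N (\<lambda>x. (\<Sum>i\<in>A. c i F x) - F x) < e"
    unfolding eventually_finite_subsets_at_top by (auto simp: dist_real_def)
  moreover have "(\<lambda>x. \<Sum>i\<in>A. c i F x) \<in> weight_dom w"
    using combination_weight_dom[OF A(1,2) F, of "\<lambda>_. 1" w] by simp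
  ultimately show "\<exists>g\<in>weight_dom w. L2_norm N (\<lambda>x. F x - g x) < e"
    using L2_norm_minus_commute[of N F] by metis
qed (rule weight_domD)

text \<open>The test functions \<open>c i h\<close> already lie in the weight domain and see every
  component. The lemma identifies adjoint and divergence, which are specified only through their
  pairing with a domain.\<close>

lemma AE_eqI_inner_weight_dom:
  assumes G: "G \<in> L2_space N" and H: "H \<in> L2_space N"
    and eq: "\<And>f. f \<in> weight_dom w \<Longrightarrow> L2_inner N f G = L2_inner N f H"
  shows "AE x in N. G x = H x"
proof (rule AE_eqI_components[OF G H AE_eqI_inner])
  fix i h assume i: "i \<in> I" and h: "h \<in> L2_space N"
  show "L2_inner N (c i G) h = L2_inner N (c i H) h"
    using eq[OF component_weight_dom[OF i h]]
    by (simp add: component_sym i G H h L2_inner_commute[of N _ "c i h"])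
qed (auto intro: component_L2 G H)

end

section \<open>Number operators\<close>

text \<open>Only finitely many \<open>n\<close> bring \<open>n + a\<close> close to 0, so the
  reciprocals are bounded where they are defined. This discreteness is what excludes spectrum other
  than eigenvalues.\<close>

lemma inverse_shifted_nat_bounded:
  fixes a :: real
  obtains B where "\<And>n::nat. real n + a \<noteq> 0 \<Longrightarrow> \<bar>1 / (real n + a)\<bar> \<le> B"
proof
  \<comment> \<open>Beyond \<open>K\<close> the shifted value is at least 1, which the inserted
    element 1 of \<open>S\<close> covers; the image covers the remaining \<open>n\<close>.\<close>
  define K where "K = nat \<lceil>\<bar>a\<bar>\<rceil> + 1"
  define S where "S = insert 1 ((\<lambda>n. \<bar>1 / (real n + a)\<bar>) ` {..K})"
  fix n :: nat assume "real n + a \<noteq> 0"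
  have S: "finite S" "1 \<in> S" by (auto simp: S_def)
  show "\<bar>1 / (real n + a)\<bar> \<le> Max S"
  proof (cases "n \<le> K")
    case True
    then show ?thesis using S by (intro Max_ge) (auto simp: S_def)
  next
    case False
    then have "real n + a \<ge> 1" unfolding K_def by linarith
    then have "\<bar>1 / (real n + a)\<bar> \<le> 1" by (simp add: field_simps)
    also have "1 \<le> Max S" using S by (intro Max_ge)
    finally show ?thesis .
  qed
qed

text \<open>The operator enters only through its domain and the components of its values, which
  suits \<open>OU_gen\<close>, a function determined merely up to null sets.\<close>

locale L2_number_operator = L2_orthogonal_decomposition N c I
  for N :: "'a measure" and c :: "'i \<Rightarrow> ('a \<Rightarrow> real) \<Rightarrow> 'a \<Rightarrow> real" and I :: "'i set" +
  fixes d :: "'i \<Rightarrow> nat" and A :: "('a \<Rightarrow> real) set" and T :: "('a \<Rightarrow> real) \<Rightarrow> 'a \<Rightarrow> real"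
  assumes dom_eq: "A = weight_dom (\<lambda>i. (real (d i))\<^sup>2)"
    and op_L2: "F \<in> A \<Longrightarrow> T F \<in> L2_space N"
    and component_op: "F \<in> A \<Longrightarrow> i \<in> I \<Longrightarrow> AE x in N. c i (T F) x = - real (d i) * c i F x"
begin

lemma dom_L2: "F \<in> A \<Longrightarrow> F \<in> L2_space N"
  by (simp add: dom_eq weight_domD)

lemma inner_op_has_sum:
  assumes F: "F \<in> A" and G: "G \<in> L2_space N"
  shows "((\<lambda>i. - real (d i) * L2_inner N (c i F) (c i G)) has_sum L2_inner N (T F) G) I"
  by (rule multiplier_inner_has_sum[OF dom_L2[OF F] op_L2[OF F] G component_op[OF F]])

lemma op_symmetric:
  assumes F: "F \<in> A" and G: "G \<in> A"
  shows "L2_inner N (T F) G = L2_inner N F (T G)"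
  using has_sum_unique[OF inner_op_has_sum[OF F dom_L2[OF G]]] inner_op_has_sum[OF G dom_L2[OF F]]
  by (metis (no_types, lifting) L2_inner_commute has_sum_cong)

lemma op_negative:
  assumes F: "F \<in> A"
  shows "L2_inner N (T F) F \<le> 0"
  using has_sum_nonneg[OF has_sum_uminusI[OF inner_op_has_sum[OF F dom_L2[OF F]]]] by simp

lemma self_adjoint: "L2_self_adjoint N A T"
  unfolding L2_self_adjoint_def
proof (intro conjI ballI equalityI subsetI)
  show "L2_dense N A" unfolding dom_eq by (rule weight_dom_dense)
next
  fix G assume G: "G \<in> A"
  have "\<bar>L2_inner N (T F) G\<bar> \<le> L2_norm N (T G) * L2_norm N F" if F: "F \<in> A" for F
    using L2_Cauchy_Schwarz[OF dom_L2[OF F] op_L2[OF G]]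
    by (simp add: op_symmetric[OF F G] mult.commute)
  then show "G \<in> adjoint_dom N A T"
    using dom_L2[OF G] by (auto simp: adjoint_dom_def L2_inner_def)
next
  fix G assume "G \<in> adjoint_dom N A T"
  then obtain C where G: "G \<in> L2_space N"
    and C: "\<And>F. F \<in> A \<Longrightarrow> \<bar>L2_inner N (T F) G\<bar> \<le> C * L2_norm N F"
    by (auto simp: adjoint_dom_def L2_inner_def)
  show "G \<in> A" unfolding dom_eq
  proof (rule weight_domI_bounded_functional[OF G])
    fix J assume J: "finite J" "J \<subseteq> I"
    \<comment> \<open>The truncation of \<open>- T G\<close>, for a \<open>G\<close> whose
      membership in the domain is still open. Pairing \<open>T ?F\<close> with \<open>G\<close>
      gives, up to sign, the partial sum that has to be bounded.\<close>
    let ?F = "\<lambda>x. \<Sum>i\<in>J. real (d i) * c i G x"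
    have F: "?F \<in> A" unfolding dom_eq by (rule combination_weight_dom[OF J(2,1) G])
    have "- real (d i) * L2_inner N (c i ?F) (c i G)
        = (if i \<in> J then - ((real (d i))\<^sup>2 * (L2_norm N (c i G))\<^sup>2) else 0)" if i: "i \<in> I" for i
    proof -
      have "L2_inner N (c i ?F) (c i G) = L2_inner N (\<lambda>x. (if i \<in> J then real (d i) else 0) * c i G x) (c i G)"
        using component_combination[OF J(2,1) G i, of "\<lambda>i. real (d i)"]
        by (intro L2_inner_cong_AE) (auto intro: component_L2 L2_space_cmult dom_L2[OF F] i G)
      then show ?thesis
        by (simp add: L2_inner_cmult_left power2_eq_square flip: L2_norm_square)
    qed
    then have "((\<lambda>i. - real (d i) * L2_inner N (c i ?F) (c i G)) has_sum
        (\<Sum>i\<in>J. - ((real (d i))\<^sup>2 * (L2_norm N (c i G))\<^sup>2))) I"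
      using J by (intro has_sum_finite_neutralI[of J]) (auto intro!: sum.cong dest: subsetD)
    from has_sum_unique[OF inner_op_has_sum[OF F G] this]
    have "\<bar>L2_inner N (T ?F) G\<bar> = (\<Sum>i\<in>J. (real (d i))\<^sup>2 * (L2_norm N (c i G))\<^sup>2)"
      by (simp add: sum_negf sum_nonneg)
    then show "(\<Sum>i\<in>J. (real (d i))\<^sup>2 * (L2_norm N (c i G))\<^sup>2) \<le> C * L2_norm N ?F"
      using C[OF F] by simp
  qed
next
  fix G assume G: "G \<in> A"
  \<comment> \<open>\<open>T G\<close> satisfies the specification of the adjoint, so
    \<open>SOME\<close> picks a genuine solution; density of the domain then makes the two
    agree.\<close>
  have *: "T G \<in> L2_space N \<and> (\<forall>F\<in>A. (\<integral>x. T F x * G x \<partial>N) = (\<integral>x. F x * T G x \<partial>N))"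
    using op_L2[OF G] op_symmetric[OF _ G] by (simp add: L2_inner_def)
  from someI[of "\<lambda>h. h \<in> L2_space N \<and> (\<forall>F\<in>A. (\<integral>x. T F x * G x \<partial>N) = (\<integral>x. F x * h x \<partial>N))", OF *]
  have adj: "adjoint_op N A T G \<in> L2_space N"
    "\<And>F. F \<in> A \<Longrightarrow> L2_inner N (T F) G = L2_inner N F (adjoint_op N A T G)"
    unfolding adjoint_op_def[symmetric] by (auto simp: L2_inner_def)
  show "AE x in N. T G x = adjoint_op N A T G x"
  proof (rule AE_eqI_inner_weight_dom[OF op_L2[OF G] adj(1)])
    fix F assume "F \<in> weight_dom (\<lambda>i. (real (d i))\<^sup>2)"
    then have F: "F \<in> A" by (simp add: dom_eq)
    then show "L2_inner N F (T G) = L2_inner N F (adjoint_op N A T G)"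
      using adj(2)[OF F] op_symmetric[OF F G] by simp
  qed
qed

section \<open>Spectrum and eigenspaces of number operators\<close>

lemma component_op_shift:
  assumes F: "F \<in> A" and i: "i \<in> I"
  shows "AE x in N. c i (\<lambda>x. T F x - a * F x) x = (- real (d i) - a) * c i F x"
  using component_diff[OF i op_L2[OF F] L2_space_cmult[OF dom_L2[OF F]], of a]
    component_cmult[OF i dom_L2[OF F], of a] component_op[OF F i]
  by eventually_elim (simp add: left_diff_distrib)

lemma op_shift_L2: "F \<in> A \<Longrightarrow> (\<lambda>x. T F x - a * F x) \<in> L2_space N"
  by (intro L2_space_diff L2_space_cmult op_L2 dom_L2)

text \<open>Components determine a function, so an equation for \<open>T - a\<close> splits into one
  scalar equation per index. Injectivity, surjectivity and eigenspaces are all read off from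
  here.\<close>

lemma op_shift_eq_iff:
  assumes F: "F \<in> A" and h: "h \<in> L2_space N"
  shows "(AE x in N. T F x - a * F x = h x) \<longleftrightarrow>
    (\<forall>i\<in>I. AE x in N. (- real (d i) - a) * c i F x = c i h x)"
proof
  assume eq: "AE x in N. T F x - a * F x = h x"
  show "\<forall>i\<in>I. AE x in N. (- real (d i) - a) * c i F x = c i h x"
  proof
    fix i assume i: "i \<in> I"
    show "AE x in N. (- real (d i) - a) * c i F x = c i h x"
      using component_cong[OF i op_shift_L2[OF F] h eq] component_op_shift[OF F i, of a]
      by eventually_elim simp
  qed
next
  assume *: "\<forall>i\<in>I. AE x in N. (- real (d i) - a) * c i F x = c i h x"
  show "AE x in N. T F x - a * F x = h x"
  proof (rule AE_eqI_components[OF op_shift_L2[OF F] h])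
    fix i assume i: "i \<in> I"
    show "AE x in N. c i (\<lambda>x. T F x - a * F x) x = c i h x"
      using component_op_shift[OF F i, of a] bspec[OF * i] by eventually_elim simp
  qed
qed

text \<open>A component \<open>c i F\<close> with \<open>d i = - a\<close> solves
  \<open>T f = a f\<close>; on every other index the scalar factor can be cancelled. The quantifier
  over \<open>F\<close> accounts for indices whose components all vanish.\<close>

lemma injective_iff:
  "L2_injective N A (\<lambda>f x. T f x - a * f x) \<longleftrightarrow>
    (\<forall>i\<in>I. \<forall>F\<in>L2_space N. real (d i) + a = 0 \<longrightarrow> (AE x in N. c i F x = 0))"
proof
  assume inj: "L2_injective N A (\<lambda>f x. T f x - a * f x)"
  show "\<forall>i\<in>I. \<forall>F\<in>L2_space N. real (d i) + a = 0 \<longrightarrow> (AE x in N. c i F x = 0)"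
  proof (intro ballI impI)
    fix i F assume i: "i \<in> I" and F: "F \<in> L2_space N" and zero: "real (d i) + a = 0"
    have cF: "c i F \<in> A" unfolding dom_eq by (rule component_weight_dom[OF i F])
    have 0: "(\<lambda>x. 0) \<in> A"
      unfolding dom_eq using combination_weight_dom[of "{}" F] F by simp
    have c0: "AE x in N. c j (\<lambda>x. 0) x = 0" if "j \<in> I" for j
      using component_cmult[OF that F, of 0] by simp
    have "AE x in N. T (c i F) x - a * c i F x = 0"
    proof (subst op_shift_eq_iff[OF cF L2_space_zero], intro ballI)
      fix j assume j: "j \<in> I"
      show "AE x in N. (- real (d j) - a) * c j (c i F) x = c j (\<lambda>x. 0) x"
        using component_component[OF j i F] c0[OF j] by eventually_elim (use zero in auto)
    qed
    \<comment> \<open>That \<open>T\<close> sends 0 to 0 has to be read off from the components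
      too.\<close>
    moreover have "AE x in N. T (\<lambda>x. 0) x - a * 0 = 0"
    proof (subst op_shift_eq_iff[OF 0 L2_space_zero], intro ballI)
      fix j assume j: "j \<in> I"
      show "AE x in N. (- real (d j) - a) * c j (\<lambda>x. 0) x = c j (\<lambda>x. 0) x"
        using c0[OF j] by eventually_elim simp
    qed
    ultimately have "AE x in N. T (c i F) x - a * c i F x = T (\<lambda>x. 0) x - a * 0"
      by eventually_elim simp
    then show "AE x in N. c i F x = 0"
      using inj cF 0 by (auto simp: L2_injective_def)
  qed
next
  assume *: "\<forall>i\<in>I. \<forall>F\<in>L2_space N. real (d i) + a = 0 \<longrightarrow> (AE x in N. c i F x = 0)"
  show "L2_injective N A (\<lambda>f x. T f x - a * f x)"
    unfolding L2_injective_def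
  proof (intro ballI impI)
    fix F G assume F: "F \<in> A" and G: "G \<in> A"
      and eq: "AE x in N. T F x - a * F x = T G x - a * G x"
    show "AE x in N. F x = G x"
    proof (rule AE_eqI_components[OF dom_L2[OF F] dom_L2[OF G]])
      fix i assume i: "i \<in> I"
      show "AE x in N. c i F x = c i G x"
      proof (cases "real (d i) + a = 0")
        case True
        then have "AE x in N. c i F x = 0" "AE x in N. c i G x = 0"
          using * i dom_L2[OF F] dom_L2[OF G] by auto
        then show ?thesis by eventually_elim simp
      next
        case False
        have "AE x in N. (- real (d i) - a) * c i F x = (- real (d i) - a) * c i G x"
          using component_cong[OF i op_shift_L2[OF F] op_shift_L2[OF G] eq]
            component_op_shift[OF F i, of a] component_op_shift[OF G i, of a]
          by eventually_elim simp
        then show ?thesis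
          by eventually_elim (use False in auto)
      qed
    qed
  qed
qed

text \<open>The solution has components \<open>w i * c i h\<close>. Boundedness of
  \<open>w i\<close> puts it into the space, boundedness of \<open>d i * w i\<close> into the
  domain.\<close>

lemma injective_imp_surjective:
  assumes inj: "L2_injective N A (\<lambda>f x. T f x - a * f x)"
  shows "L2_surjective N A (\<lambda>f x. T f x - a * f x)"
  unfolding L2_surjective_def
proof
  fix h assume h: "h \<in> L2_space N"
  \<comment> \<open>For \<open>d i + a = 0\<close> division by zero gives \<open>w i = 0\<close>, a
    suitable value because injectivity then forces \<open>c i h = 0\<close>.\<close>
  define w where "w i = - (1 / (real (d i) + a))" for i
  obtain B where B: "\<And>n::nat. real n + a \<noteq> 0 \<Longrightarrow> \<bar>1 / (real n + a)\<bar> \<le> B"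
    using inverse_shifted_nat_bounded by blast
  have w: "\<bar>w i\<bar> \<le> \<bar>B\<bar>" for i
    using B[of "d i"] by (cases "real (d i) + a = 0") (auto simp: w_def)
  have dw: "\<bar>real (d i) * w i\<bar> \<le> 1 + \<bar>a\<bar> * \<bar>B\<bar>" for i
  proof (cases "real (d i) + a = 0")
    case False
    then have "real (d i) * w i = - 1 - a * w i" by (simp add: w_def field_simps)
    then have "\<bar>real (d i) * w i\<bar> \<le> 1 + \<bar>a * w i\<bar>" by linarith
    also have "\<dots> \<le> 1 + \<bar>a\<bar> * \<bar>B\<bar>" using w[of i] by (simp add: abs_mult mult_left_mono)
    finally show ?thesis .
  next
    case True
    then have "w i = 0" by (simp add: w_def)
    then show ?thesis by simp
  qed
  have "(w i)\<^sup>2 \<le> B\<^sup>2" for i using w[of i] by (simp only: abs_le_square_iff)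
  then have "h \<in> weight_dom (\<lambda>i. (w i)\<^sup>2)"
    by (intro weight_dom_bounded[OF h, of _ "B\<^sup>2"]) simp_all
  from multiplier_exists[OF this] obtain F where F: "F \<in> L2_space N"
    and comp: "\<And>i. i \<in> I \<Longrightarrow> AE x in N. c i F x = w i * c i h x"
    by blast
  have "(real (d i) * w i)\<^sup>2 \<le> (1 + \<bar>a\<bar> * \<bar>B\<bar>)\<^sup>2" for i
    using power_mono[OF dw[of i] abs_ge_zero, of 2] by (simp only: power2_abs)
  then have "h \<in> weight_dom (\<lambda>i. (real (d i) * w i)\<^sup>2)"
    by (intro weight_dom_bounded[OF h, of _ "(1 + \<bar>a\<bar> * \<bar>B\<bar>)\<^sup>2"]) simp_all
  moreover have "L2_norm N (c i F) = \<bar>w i\<bar> * L2_norm N (c i h)" if "i \<in> I" for i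
    using L2_norm_cong_AE[OF comp[OF that] component_L2[OF that F] L2_space_cmult[OF component_L2[OF that h]]]
    by (simp add: L2_norm_cmult)
  ultimately have FA: "F \<in> A"
    using F by (simp add: dom_eq weight_dom_def power_mult_distrib mult.assoc cong: summable_on_cong)
  have "AE x in N. T F x - a * F x = h x"
  proof (subst op_shift_eq_iff[OF FA h], intro ballI)
    fix i assume i: "i \<in> I"
    show "AE x in N. (- real (d i) - a) * c i F x = c i h x"
    proof (cases "real (d i) + a = 0")
      case True
      have "AE x in N. c i h x = 0" using inj i h True by (simp add: injective_iff)
      then show ?thesis by eventually_elim (use True in auto)
    next
      case False
      show ?thesis using comp[OF i] by eventually_elim (use False in \<open>simp add: w_def field_simps\<close>)
    qed
  qed
  then show "\<exists>f\<in>A. AE x in N. T f x - a * f x = h x" using FA by blast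
qed

lemma spectrum_eq_point_spectrum: "spectrum N A T = point_spectrum N A T"
  using injective_imp_surjective by (auto simp: spectrum_def point_spectrum_def)

lemma point_spectrum_subset: "point_spectrum N A T \<subseteq> {real_of_int p | p. p \<le> 0}"
proof
  fix a assume "a \<in> point_spectrum N A T"
  then obtain i where "real (d i) + a = 0" by (auto simp: point_spectrum_def injective_iff)
  then have "a = real_of_int (- int (d i))" by simp
  then show "a \<in> {real_of_int p | p. p \<le> 0}" by fastforce
qed

text \<open>The \<open>SOME\<close> term is \<open>hoeffding_part\<close> for an abstract
  decomposition. Both sides describe the \<open>F\<close> whose components off the level
  \<open>p\<close> vanish: for the eigenspace by the scalar equations, for the sum because its
  components are those of \<open>F\<close> on the level and 0 elsewhere.\<close>

lemma eigenspace_eq: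
  "eigenspace N A T (- real p) = {F \<in> L2_space N.
    AE x in N. F x = (SOME G. L2_has_sum N (\<lambda>i. c i F) {i \<in> I. d i = p} G) x}"
    (is "_ = {F \<in> L2_space N. AE x in N. F x = ?S F x}")
proof -
  have c0: "AE x in N. c j (\<lambda>x. 0) x = 0" if "j \<in> I" for j
    using component_cmult[OF that L2_space_zero, of 0] by simp
  have part: "?S F \<in> L2_space N \<and> (\<forall>i\<in>I. AE x in N. c i (?S F) x = (if d i = p then 1 else 0) * c i F x)"
    if F: "F \<in> L2_space N" for F
  proof -
    let ?J = "{i \<in> I. d i = p}"
    have "F \<in> weight_dom (\<lambda>i. (if d i = p then 1 else 0)\<^sup>2)"
      by (rule weight_dom_bounded[OF F, of _ 1]) auto
    from multiplier_exists[OF this] obtain G where G: "G \<in> L2_space N"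
      and comp: "\<And>i. i \<in> I \<Longrightarrow> AE x in N. c i G x = (if d i = p then 1 else 0) * c i F x"
      by blast
    have G_sum: "L2_has_sum N (\<lambda>i. c i F) ?J G"
      using comp by (intro components_has_sum[OF F G]) auto
    then have S_sum: "L2_has_sum N (\<lambda>i. c i F) ?J (?S F)" by (rule someI[of "L2_has_sum N (\<lambda>i. c i F) ?J"])
    then have S: "?S F \<in> L2_space N" by (simp add: L2_has_sum_def)
    have eq: "AE x in N. ?S F x = G x" using component_L2[OF _ F] by (intro L2_has_sum_unique[OF _ S_sum G_sum]) auto
    show ?thesis
    proof (intro conjI ballI S)
      fix i assume i: "i \<in> I"
      show "AE x in N. c i (?S F) x = (if d i = p then 1 else 0) * c i F x"
        using component_cong[OF i S G eq] comp[OF i] by eventually_elim simp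
    qed
  qed
  show ?thesis
  proof (intro equalityI subsetI)
    fix F assume "F \<in> eigenspace N A T (- real p)"
    then have FA: "F \<in> A" and eig: "AE x in N. T F x - (- real p) * F x = 0"
      by (auto simp: eigenspace_def)
    have F: "F \<in> L2_space N" using dom_L2[OF FA] .
    have "AE x in N. F x = ?S F x"
    proof (rule AE_eqI_components[OF F])
      fix i assume i: "i \<in> I"
      have "AE x in N. (- real (d i) - (- real p)) * c i F x = c i (\<lambda>x. 0) x"
        using iffD1[OF op_shift_eq_iff[OF FA L2_space_zero] eig] i by blast
      then show "AE x in N. c i F x = c i (?S F) x"
        using bspec[OF conjunct2[OF part[OF F]] i] c0[OF i] by eventually_elim auto
    qed (use part[OF F] in blast)
    then show "F \<in> {F \<in> L2_space N. AE x in N. F x = ?S F x}" using F by simp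
  next
    fix F assume "F \<in> {F \<in> L2_space N. AE x in N. F x = ?S F x}"
    then have F: "F \<in> L2_space N" and eq: "AE x in N. F x = ?S F x" by auto
    have zero: "AE x in N. c i F x = 0" if i: "i \<in> I" and "d i \<noteq> p" for i
      using component_cong[OF i F conjunct1[OF part[OF F]] eq] bspec[OF conjunct2[OF part[OF F]] i]
      by eventually_elim (use that in simp)
    \<comment> \<open>Since the components off the level vanish, the weight may be replaced by the
      constant \<open>p\<^sup>2\<close>, and a constant weight imposes no condition.\<close>
    have weight: "(real (d i))\<^sup>2 * (L2_norm N (c i F))\<^sup>2 = (real p)\<^sup>2 * (L2_norm N (c i F))\<^sup>2" if i: "i \<in> I" for i
      using zero[OF i] L2_norm_eq_0_iff[OF component_L2[OF i F]] by (cases "d i = p") auto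
    have "F \<in> weight_dom (\<lambda>i. (real p)\<^sup>2)" by (rule weight_dom_bounded[OF F]) auto
    moreover have "(\<lambda>i. (real (d i))\<^sup>2 * (L2_norm N (c i F))\<^sup>2) summable_on I \<longleftrightarrow>
        (\<lambda>i. (real p)\<^sup>2 * (L2_norm N (c i F))\<^sup>2) summable_on I"
      by (rule summable_on_cong) (rule weight)
    ultimately have FA: "F \<in> A" by (simp add: dom_eq weight_dom_def)
    have "AE x in N. T F x - (- real p) * F x = 0"
    proof (subst op_shift_eq_iff[OF FA L2_space_zero], intro ballI)
      fix i assume i: "i \<in> I"
      show "AE x in N. (- real (d i) - (- real p)) * c i F x = c i (\<lambda>x. 0) x"
      proof (cases "d i = p")
        case True
        then show ?thesis using c0[OF i] by simp
      next
        case False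
        show ?thesis using c0[OF i] zero[OF i False] by eventually_elim simp
      qed
    qed
    then show "F \<in> eigenspace N A T (- real p)" using FA by (simp add: eigenspace_def)
  qed
qed

end

section \<open>Independent sequences and conditional expectations\<close>

text \<open>Pairing \<open>S\<close> with \<open>insert x S\<close> cancels the terms. Every
  vanishing statement about Hoeffding components below comes from an index \<open>x\<close> that the
  summand does not see.\<close>

lemma alternating_sum_Pow_eq_0:
  fixes f :: "'b set \<Rightarrow> real"
  assumes M: "finite M" "x \<in> M" and f: "\<And>S. S \<subseteq> M \<Longrightarrow> x \<notin> S \<Longrightarrow> f (insert x S) = f S"
  shows "(\<Sum>S\<in>Pow M. (-1) ^ (card M - card S) * f S) = 0"
proof -
  define M' where "M' = M - {x}"
  have M': "M = insert x M'" "x \<notin> M'" "finite M'" using M by (auto simp: M'_def)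
  have inj: "inj_on (insert x) (Pow M')" using M' by (auto simp: inj_on_def)
  have "(\<Sum>S\<in>Pow M. (-1) ^ (card M - card S) * f S)
      = (\<Sum>S\<in>Pow M'. (-1) ^ (card M - card S) * f S)
        + (\<Sum>S\<in>Pow M'. (-1) ^ (card M - card (insert x S)) * f (insert x S))"
    unfolding M'(1) Pow_insert
    using M' by (subst sum.union_disjoint) (auto simp: sum.reindex[OF inj])
  also have "(\<Sum>S\<in>Pow M'. (-1) ^ (card M - card S) * f S)
      = (\<Sum>S\<in>Pow M'. - ((-1) ^ (card M - card (insert x S)) * f (insert x S)))"
  proof (rule sum.cong)
    fix S assume "S \<in> Pow M'"
    then have S: "S \<subseteq> M'" "finite S" "x \<notin> S" "card S \<le> card M'"
      using M' by (auto intro: finite_subset card_mono)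
    then have "card M - card S = Suc (card M - card (insert x S))" using M' by simp
    moreover have "f (insert x S) = f S" using S M' by (intro f) auto
    ultimately show "(-1) ^ (card M - card S) * f S = - ((-1) ^ (card M - card (insert x S)) * f (insert x S))"
      by simp
  qed simp
  finally show ?thesis by (simp add: sum_negf)
qed

text \<open>The sets over which \<open>U\<close> integrates to 0 form a Dynkin system; complements
  are covered because \<open>space M\<close> itself belongs to \<open>G\<close>. No sign condition
  on \<open>U\<close> enters, so differences of functions can be treated.\<close>

lemma (in prob_space) set_integral_eq_0_sigma_sets:
  fixes U :: "'a \<Rightarrow> real"
  assumes U: "integrable M U" and G: "Int_stable G" "G \<subseteq> events" "space M \<in> G"
    and zero: "\<And>A. A \<in> G \<Longrightarrow> (LINT x:A|M. U x) = 0"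
    and A: "A \<in> sigma_sets (space M) G"
  shows "(LINT x:A|M. U x) = 0"
proof -
  have sub: "sigma_sets (space M) G \<subseteq> events" using G(2) by (rule sets.sigma_sets_subset)
  have int: "set_integrable M B U" if "B \<in> events" for B
    using integrable_mult_indicator[OF that U] by (simp add: set_integrable_def)
  have "G \<subseteq> Pow (space M)" using G(2) sets.sets_into_space by blast
  from G(1) this A show ?thesis
  proof (induction rule: sigma_sets_induct_disjoint)
    case (basic A)
    then show ?case by (rule zero)
  next
    case empty
    then show ?case by (simp add: set_lebesgue_integral_def)
  next
    case (compl A)
    then have A: "A \<in> events" using sub by auto
    have "(LINT x:(A \<union> (space M - A))|M. U x) = (LINT x:A|M. U x) + (LINT x:(space M - A)|M. U x)"
      using A by (intro set_integral_Un int) auto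
    moreover have "A \<union> (space M - A) = space M" using sets.sets_into_space[OF A] by auto
    ultimately show ?case using compl.IH zero[OF G(3)] by simp
  next
    case (union A)
    then have A: "A i \<in> events" for i using sub by auto
    have "(LINT x:(\<Union>i. A i)|M. U x) = (\<Sum>i. (LINT x:(A i)|M. U x))"
      using A union.hyps by (intro lebesgue_integral_countable_add int) (auto simp: disjoint_family_on_def)
    then show ?case using union.IH by simp
  qed
qed

locale independent_sequence = prob_space P for P :: "'a measure" +
  fixes E :: "nat \<Rightarrow> 'e measure" and X :: "nat \<Rightarrow> 'a \<Rightarrow> 'e"
  assumes indep: "indep_vars E X UNIV"
begin

abbreviation "N \<equiv> PF P E X"
abbreviation "CE J \<equiv> real_cond_exp P (sigX P E X J)"
abbreviation "hoeff M F \<equiv> hoeffding_component P E X F M"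

definition gen :: "nat \<Rightarrow> 'a set set" where
  "gen j = {X j -` B \<inter> space P | B. B \<in> sets (E j)}"

lemma gen_indep: "indep_sets gen UNIV"
  using indep unfolding indep_vars_def2 gen_def by simp

lemma gen_events: "gen j \<subseteq> events"
  using gen_indep by (auto simp: indep_sets_def)

lemma gen_Int_stable: "Int_stable (gen j)"
proof (rule Int_stableI)
  fix A B assume "A \<in> gen j" "B \<in> gen j"
  then obtain A' B' where *: "A' \<in> sets (E j)" "B' \<in> sets (E j)"
    "A = X j -` A' \<inter> space P" "B = X j -` B' \<inter> space P"
    by (auto simp: gen_def)
  then have "A \<inter> B = X j -` (A' \<inter> B') \<inter> space P" by auto
  moreover have "A' \<inter> B' \<in> sets (E j)" using * by auto
  ultimately show "A \<inter> B \<in> gen j" unfolding gen_def by blast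
qed

lemma space_sigX [simp]: "space (sigX P E X J) = space P"
  by (simp add: sigX_def space_measure_of_conv)

lemma sets_sigX: "sets (sigX P E X J) = sigma_sets (space P) (\<Union>j\<in>J. gen j)"
  unfolding sigX_def gen_def by (rule sets_measure_of) auto

lemma sets_sigX_mono: "J \<subseteq> K \<Longrightarrow> sets (sigX P E X J) \<subseteq> sets (sigX P E X K)"
  unfolding sets_sigX by (intro sigma_sets_subseteq) auto

lemma sets_sigX_events: "sets (sigX P E X J) \<subseteq> events"
  unfolding sets_sigX using gen_events by (intro sets.sigma_sets_subset) auto

lemma subalgebra_sigX: "subalgebra P (sigX P E X J)"
  using sets_sigX_events by (simp add: subalgebra_def)

lemma subalgebra_sigX_mono: "J \<subseteq> K \<Longrightarrow> subalgebra (sigX P E X K) (sigX P E X J)"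
  using sets_sigX_mono by (simp add: subalgebra_def)

sublocale sub: finite_measure_subalgebra P "sigX P E X J" for J
  by unfold_locales (rule subalgebra_sigX)

text \<open>Intersection-stable generators may be grouped into disjoint blocks without losing
  independence; \<open>case_bool\<close> presents the two blocks in the form in which
  \<open>indep_set\<close> is defined.\<close>

lemma indep_sigX:
  assumes "J \<inter> K = {}"
  shows "indep_set (sets (sigX P E X J)) (sets (sigX P E X K))"
proof -
  have "indep_sets (\<lambda>b. sigma_sets (space P) (\<Union>i\<in>case_bool J K b. gen i)) UNIV"
    using assms gen_Int_stable
    by (intro indep_sets_collect_sigma indep_sets_mono_index[OF subset_UNIV gen_indep])
       (auto simp: disjoint_family_on_def split: bool.splits)
  also have "(\<lambda>b. sigma_sets (space P) (\<Union>i\<in>case_bool J K b. gen i))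
      = case_bool (sets (sigX P E X J)) (sets (sigX P E X K))"
    by (auto simp: fun_eq_iff sets_sigX split: bool.splits)
  finally show ?thesis unfolding indep_set_def .
qed

section \<open>Passing between \<open>P\<close> and its restriction \<open>N\<close>\<close>

lemma prob_space_N: "prob_space N"
  unfolding PF_def by (rule prob_space_restr_to_subalg[OF subalgebra_sigX prob_space_axioms])

lemma measurable_N: "f \<in> borel_measurable N \<longleftrightarrow> f \<in> borel_measurable (sigX P E X UNIV)"
  for f :: "'a \<Rightarrow> real"
  unfolding PF_def by (intro arg_cong[where f = "\<lambda>S. f \<in> S"] measurable_cong_sets)
    (simp_all add: sets_restr_to_subalg[OF subalgebra_sigX])

lemma measurable_sigX_N:
  "f \<in> borel_measurable (sigX P E X J) \<Longrightarrow> f \<in> borel_measurable N" for f :: "'a \<Rightarrow> real"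
  unfolding measurable_N by (rule measurable_from_subalg[OF subalgebra_sigX_mono[OF subset_UNIV]])

lemma integral_N: "f \<in> borel_measurable N \<Longrightarrow> (\<integral>x. f x \<partial>N) = (\<integral>x. f x \<partial>P)" for f :: "'a \<Rightarrow> real"
  unfolding measurable_N unfolding PF_def by (rule integral_subalgebra2[OF subalgebra_sigX])

lemma integrable_N:
  "f \<in> borel_measurable N \<Longrightarrow> integrable N f \<longleftrightarrow> integrable P f" for f :: "'a \<Rightarrow> real"
  unfolding measurable_N unfolding PF_def
  using integrable_from_subalg[OF subalgebra_sigX] integrable_in_subalg[OF subalgebra_sigX] by blast

text \<open>A null set of \<open>P\<close> need not be covered by a null set of \<open>N\<close>;
  here the exceptional set itself lies in the smaller sigma-algebra, because both functions are
  measurable there.\<close>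

lemma AE_N_eqI:
  assumes "AE x in P. f x = g x" "f \<in> borel_measurable N" "g \<in> borel_measurable N"
  shows "AE x in N. f x = (g x :: real)"
proof -
  have [measurable]: "f \<in> borel_measurable (sigX P E X UNIV)" "g \<in> borel_measurable (sigX P E X UNIV)"
    using assms by (simp_all add: measurable_N)
  show ?thesis unfolding PF_def
    by (rule AE_restr_to_subalg2[OF subalgebra_sigX assms(1)]) measurable
qed

lemma L2_N_iff: "f \<in> L2_space N \<longleftrightarrow> f \<in> borel_measurable N \<and> integrable P (\<lambda>x. (f x)\<^sup>2)"
  by (auto simp: L2_space_def integrable_N)

lemma L2_N_measurable_P: "f \<in> L2_space N \<Longrightarrow> f \<in> borel_measurable P"
  unfolding L2_N_iff measurable_N using measurable_from_subalg[OF subalgebra_sigX] by blast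

lemma L2_N_integrable: "f \<in> L2_space N \<Longrightarrow> integrable P f"
  using L2_norm_L1(1)[OF prob_space_N, of f] integrable_N by blast

lemma L2_inner_N:
  assumes "f \<in> L2_space N" "g \<in> L2_space N"
  shows "L2_inner N f g = (\<integral>x. f x * g x \<partial>P)" "integrable P (\<lambda>x. f x * g x)"
proof -
  have *: "(\<lambda>x. f x * g x) \<in> borel_measurable N" using assms by measurable
  show "L2_inner N f g = (\<integral>x. f x * g x \<partial>P)" unfolding L2_inner_def by (rule integral_N[OF *])
  show "integrable P (\<lambda>x. f x * g x)"
    using L2_space_mult_integrable[OF assms] integrable_N[OF *] by simp
qed

lemma CE_measurable_N: "CE J F \<in> borel_measurable N"
  by (rule measurable_sigX_N[OF borel_measurable_cond_exp])

lemma CE_L2: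
  assumes F: "F \<in> L2_space N"
  shows "CE J F \<in> L2_space N"
proof -
  have "integrable P (\<lambda>x. (CE J F x)\<^sup>2)"
  proof (rule sub.integrable_convex_cond_exp[OF L2_N_integrable[OF F], where I = UNIV and q = "\<lambda>x. x\<^sup>2"])
    show "integrable P (\<lambda>x. (F x)\<^sup>2)" using F by (simp add: L2_N_iff)
    show "convex_on UNIV (\<lambda>x::real. x\<^sup>2)" by (rule convex_power2)
  qed auto
  then show ?thesis by (simp add: L2_N_iff CE_measurable_N)
qed

text \<open>The factor \<open>CE J F\<close> is measurable for the conditioning sigma-algebra and
  can be pulled into the conditional expectation of \<open>G\<close>. Self-adjointness of
  \<open>CE J\<close> follows by exchanging roles.\<close>

lemma inner_CE:
  assumes F: "F \<in> L2_space N" and G: "G \<in> L2_space N"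
  shows "L2_inner N (CE J F) (CE J G) = L2_inner N (CE J F) G"
  unfolding L2_inner_N(1)[OF CE_L2[OF F] CE_L2[OF G]] L2_inner_N(1)[OF CE_L2[OF F] G]
  by (rule sub.real_cond_exp_intg(2)[OF L2_inner_N(2)[OF CE_L2[OF F] G]])
     (auto intro: L2_N_measurable_P G)

lemma CE_sym:
  assumes F: "F \<in> L2_space N" and G: "G \<in> L2_space N"
  shows "L2_inner N (CE J F) G = L2_inner N F (CE J G)"
  using inner_CE[OF F G, of J] inner_CE[OF G F, of J]
  by (metis L2_inner_commute)

text \<open>If \<open>U\<close> is \<open>\<F>\<^sub>K\<close>-measurable with \<open>E[U | \<F>\<^bsub>J \<inter> K\<^esub>] = 0\<close>, then \<open>U\<close> integrates to zero over
  \<open>B\<^sub>1 \<inter> B\<^sub>2\<close> with \<open>B\<^sub>1 \<in> \<F>\<^bsub>J \<inter> K\<^esub>\<close>, \<open>B\<^sub>2 \<in> \<F>\<^bsub>J - K\<^esub>\<close> by independence, and these sets generate \<open>\<F>\<^sub>J\<close>.\<close>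

lemma CE_CE:
  assumes F: "F \<in> L2_space N"
  shows "AE x in N. CE J (CE K F) x = CE (J \<inter> K) F x"
proof (rule AE_N_eqI[OF _ CE_measurable_N CE_measurable_N], rule sub.real_cond_exp_charact)
  have int: "integrable P F" by (rule L2_N_integrable[OF F])
  have intK: "integrable P (CE K F)" and intJK: "integrable P (CE (J \<inter> K) F)"
    by (auto intro: sub.real_cond_exp_int(1) int)
  show "integrable P (CE K F)" "integrable P (CE (J \<inter> K) F)" by fact+
  show "CE (J \<inter> K) F \<in> borel_measurable (sigX P E X J)"
    by (rule measurable_from_subalg[OF subalgebra_sigX_mono[of "J \<inter> K"]]) auto
  have set_int: "set_integrable P B f" if "B \<in> events" "integrable P f" for B and f :: "'a \<Rightarrow> real"
    unfolding set_integrable_def using that by (rule integrable_mult_indicator)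
  define U where "U x = CE K F x - CE (J \<inter> K) F x" for x
  have U: "integrable P U" unfolding U_def using intK intJK by auto
  have U_meas: "U \<in> borel_measurable (sigX P E X K)"
    unfolding U_def
    by (intro borel_measurable_diff borel_measurable_cond_exp
        measurable_from_subalg[OF subalgebra_sigX_mono[of "J \<inter> K" K]]) auto
  have U0: "(LINT x:B|P. U x) = 0" if B: "B \<in> sets (sigX P E X (J \<inter> K))" for B
  proof -
    have BK: "B \<in> sets (sigX P E X K)" using sets_sigX_mono[of "J \<inter> K" K] B by auto
    have "B \<in> events" using B sets_sigX_events by auto
    then have "(LINT x:B|P. U x) = (LINT x:B|P. CE K F x) - (LINT x:B|P. CE (J \<inter> K) F x)"
      unfolding U_def
      by (intro set_integral_diff) (auto intro: set_int intK intJK)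
    also have "\<dots> = 0"
      using sub.real_cond_exp_intA[OF int BK] sub.real_cond_exp_intA[OF int B] by simp
    finally show ?thesis .
  qed
  define G where "G = {B1 \<inter> B2 | B1 B2. B1 \<in> sets (sigX P E X (J \<inter> K)) \<and> B2 \<in> sets (sigX P E X (J - K))}"
  have G_events: "G \<subseteq> events" unfolding G_def using sets_sigX_events by blast
  have G_space: "space P \<in> G"
    unfolding G_def using sets.top[of "sigX P E X (J \<inter> K)"] sets.top[of "sigX P E X (J - K)"] by force
  have G_Int: "Int_stable G"
  proof (rule Int_stableI)
    fix A B assume "A \<in> G" "B \<in> G"
    then obtain A1 A2 B1 B2 where *: "A = A1 \<inter> A2" "B = B1 \<inter> B2"
      "A1 \<in> sets (sigX P E X (J \<inter> K))" "B1 \<in> sets (sigX P E X (J \<inter> K))"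
      "A2 \<in> sets (sigX P E X (J - K))" "B2 \<in> sets (sigX P E X (J - K))"
      by (auto simp: G_def)
    then have "A \<inter> B = (A1 \<inter> B1) \<inter> (A2 \<inter> B2)" by auto
    then show "A \<inter> B \<in> G" using * unfolding G_def by blast
  qed
  have G_zero: "(LINT x:A|P. U x) = 0" if "A \<in> G" for A
  proof -
    obtain B1 B2 where A: "A = B1 \<inter> B2" and B1: "B1 \<in> sets (sigX P E X (J \<inter> K))"
      and B2: "B2 \<in> sets (sigX P E X (J - K))"
      using \<open>A \<in> G\<close> by (auto simp: G_def)
    have ev: "B1 \<in> events" "B2 \<in> events" using B1 B2 sets_sigX_events by auto
    let ?Y = "\<lambda>x. indicator B1 x * U x" and ?Z = "\<lambda>x. indicator B2 x :: real"
    have Y: "?Y \<in> borel_measurable (sigX P E X K)"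
      using U_meas B1 sets_sigX_mono[of "J \<inter> K" K] by (intro borel_measurable_times borel_measurable_indicator) auto
    have Z: "?Z \<in> borel_measurable (sigX P E X (J - K))"
      using B2 by (rule borel_measurable_indicator)
    have vim: "sigma_sets (space P) {V -` A \<inter> space P |A. A \<in> sets borel} \<subseteq> sets (sigX P E X L)"
      if V: "V \<in> borel_measurable (sigX P E X L)" for V :: "'a \<Rightarrow> real" and L
      using sets.sigma_sets_subset[of "{V -` A \<inter> space P |A. A \<in> sets borel}" "sigX P E X L"]
        measurable_sets[OF V] by auto
    have indepYZ: "indep_var borel ?Y borel ?Z"
      unfolding indep_var_eq
    proof (intro conjI)
      show "?Y \<in> borel_measurable P" "?Z \<in> borel_measurable P"
        using measurable_from_subalg[OF subalgebra_sigX] Y Z by blast+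
      have "indep_set (sets (sigX P E X K)) (sets (sigX P E X (J - K)))"
        by (rule indep_sigX) auto
      then show "indep_set (sigma_sets (space P) {?Y -` A \<inter> space P |A. A \<in> sets borel})
          (sigma_sets (space P) {?Z -` A \<inter> space P |A. A \<in> sets borel})"
        using vim[OF Y] vim[OF Z] unfolding indep_sets2_eq by blast
    qed
    have "(LINT x:A|P. U x) = (\<integral>x. ?Y x * ?Z x \<partial>P)"
      unfolding set_lebesgue_integral_def A by (intro Bochner_Integration.integral_cong) (auto simp: indicator_def)
    also have "\<dots> = (\<integral>x. ?Y x \<partial>P) * (\<integral>x. ?Z x \<partial>P)"
      using integrable_mult_indicator[OF ev(1) U] ev(2)
      by (intro indep_var_lebesgue_integral[OF indepYZ]) (auto simp: emeasure_eq_measure)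
    also have "(\<integral>x. ?Y x \<partial>P) = 0"
      using U0[OF B1] by (simp add: set_lebesgue_integral_def)
    finally show ?thesis by simp
  qed
  have sigX_G: "sets (sigX P E X J) \<subseteq> sigma_sets (space P) G"
    unfolding sets_sigX[of J]
  proof (rule sigma_sets_mono, rule subsetI)
    fix A assume "A \<in> (\<Union>j\<in>J. gen j)"
    then obtain j where j: "j \<in> J" "A \<in> gen j" by auto
    have A: "A = A \<inter> space P" "A = space P \<inter> A"
      using j(2) gen_events sets.sets_into_space by blast+
    have top: "space P \<in> sets (sigX P E X L)" for L
      using sets.top[of "sigX P E X L"] by simp
    have genL: "A \<in> sets (sigX P E X L)" if "j \<in> L" for L
      unfolding sets_sigX using that j by auto
    \<comment> \<open>\<open>A\<close> enters through the block containing \<open>j\<close>, with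
      the whole space as the other factor.\<close>
    have "A \<in> G"
    proof (cases "j \<in> K")
      case True
      then show ?thesis unfolding G_def using A(1) genL[of "J \<inter> K"] j top by blast
    next
      case False
      then show ?thesis unfolding G_def using A(2) genL[of "J - K"] j top by blast
    qed
    then show "A \<in> sigma_sets (space P) G" by auto
  qed
  fix A assume A: "A \<in> sets (sigX P E X J)"
  have Aev: "A \<in> events" using A sets_sigX_events by auto
  have "(LINT x:A|P. U x) = 0"
    using A sigX_G by (intro set_integral_eq_0_sigma_sets[OF U G_Int G_events G_space G_zero]) auto
  moreover have "(LINT x:A|P. U x) = (LINT x:A|P. CE K F x) - (LINT x:A|P. CE (J \<inter> K) F x)"
    unfolding U_def using Aev
    by (intro set_integral_diff) (auto intro: set_int intK intJK)
  ultimately show "(LINT x:A|P. CE K F x) = (LINT x:A|P. CE (J \<inter> K) F x)" by simp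
qed

end

section \<open>The Hoeffding decomposition\<close>

context independent_sequence
begin

section \<open>Mean-square convergence along the first \<open>n\<close> variables\<close>

lemma inner_CE_CE_subset:
  assumes F: "F \<in> L2_space N" and "J \<subseteq> K"
  shows "L2_inner N (CE K F) (CE J F) = (L2_norm N (CE J F))\<^sup>2"
proof -
  have "L2_inner N (CE K F) (CE J F) = L2_inner N F (CE K (CE J F))"
    by (rule CE_sym[OF F CE_L2[OF F]])
  also have "\<dots> = L2_inner N F (CE J F)"
    using CE_CE[OF F, of K J] \<open>J \<subseteq> K\<close>
    by (intro L2_inner_cong_AE) (auto intro: CE_L2 F simp: Int_absorb1)
  also have "\<dots> = (L2_norm N (CE J F))\<^sup>2"
    by (simp add: L2_norm_square inner_CE[OF F F] L2_inner_commute[of N F])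
  finally show ?thesis .
qed

lemma norm_CE_diff:
  assumes F: "F \<in> L2_space N" and "J \<subseteq> K"
  shows "(L2_norm N (\<lambda>x. CE K F x - CE J F x))\<^sup>2 = (L2_norm N (CE K F))\<^sup>2 - (L2_norm N (CE J F))\<^sup>2"
  by (simp add: L2_norm_square_diff[OF CE_L2[OF F] CE_L2[OF F]] inner_CE_CE_subset[OF assms])

lemma norm_diff_CE:
  assumes F: "F \<in> L2_space N"
  shows "(L2_norm N (\<lambda>x. F x - CE J F x))\<^sup>2 = (L2_norm N F)\<^sup>2 - (L2_norm N (CE J F))\<^sup>2"
  by (simp add: L2_norm_square_diff[OF F CE_L2[OF F]] L2_norm_square[of N "CE J F"]
      inner_CE[OF F F] L2_inner_commute[of N F])

lemma norm_CE_mono: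
  assumes F: "F \<in> L2_space N" and "J \<subseteq> K"
  shows "(L2_norm N (CE J F))\<^sup>2 \<le> (L2_norm N (CE K F))\<^sup>2"
  using norm_CE_diff[OF assms] zero_le_power2[of "L2_norm N (\<lambda>x. CE K F x - CE J F x)"] by linarith

lemma norm_CE_le:
  assumes F: "F \<in> L2_space N"
  shows "(L2_norm N (CE J F))\<^sup>2 \<le> (L2_norm N F)\<^sup>2"
  using norm_diff_CE[OF assms, of J] zero_le_power2[of "L2_norm N (\<lambda>x. F x - CE J F x)"] by linarith

text \<open>Events depending on finitely many variables form an intersection-stable generator, so
  equal integrals extend to all events of the sequence, and there each function is its own
  conditional expectation.\<close>

lemma AE_eqI_integrals_cylinder:
  assumes F: "F \<in> L2_space N" and G: "G \<in> L2_space N"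
    and eq: "\<And>A m. A \<in> sets (sigX P E X {..<m}) \<Longrightarrow> (LINT x:A|P. F x) = (LINT x:A|P. G x)"
  shows "AE x in N. F x = G x"
proof (rule AE_N_eqI)
  let ?G = "\<Union>m. sets (sigX P E X {..<m})"
  have F': "integrable P F" and G': "integrable P G" using F G by (auto intro: L2_N_integrable)
  have set_int: "set_integrable P B f" if "B \<in> events" "integrable P f" for B and f :: "'a \<Rightarrow> real"
    unfolding set_integrable_def using that by (rule integrable_mult_indicator)
  have diff: "(LINT x:A|P. F x - G x) = (LINT x:A|P. F x) - (LINT x:A|P. G x)" if "A \<in> events" for A
    by (intro set_integral_diff set_int that F' G')
  have stable: "Int_stable ?G"
  proof (rule Int_stableI)
    fix A B assume "A \<in> ?G" "B \<in> ?G"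
    then obtain m n where "A \<in> sets (sigX P E X {..<m})" "B \<in> sets (sigX P E X {..<n})" by auto
    then have "A \<in> sets (sigX P E X {..<max m n})" "B \<in> sets (sigX P E X {..<max m n})"
      using sets_sigX_mono[of "{..<m}" "{..<max m n}"] sets_sigX_mono[of "{..<n}" "{..<max m n}"] by auto
    then show "A \<inter> B \<in> ?G" by blast
  qed
  have sigX_UNIV: "sets (sigX P E X UNIV) \<subseteq> sigma_sets (space P) ?G"
    unfolding sets_sigX[of UNIV]
  proof (rule sigma_sets_mono, rule subsetI)
    fix A assume "A \<in> (\<Union>j\<in>UNIV. gen j)"
    then obtain j where "A \<in> gen j" by auto
    then have "A \<in> sets (sigX P E X {..<Suc j})" unfolding sets_sigX by auto
    then show "A \<in> sigma_sets (space P) ?G" by auto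
  qed
  have "(LINT x:A|P. F x) = (LINT x:A|P. G x)" if A: "A \<in> sets (sigX P E X UNIV)" for A
  proof -
    have "(LINT x:A|P. F x - G x) = 0"
    proof (rule set_integral_eq_0_sigma_sets[OF _ stable])
      show "integrable P (\<lambda>x. F x - G x)" using F' G' by auto
      show "?G \<subseteq> events" using sets_sigX_events by auto
      show "space P \<in> ?G" using sets.top[of "sigX P E X {..<0}"] by (intro UN_I[of 0]) simp_all
      show "(LINT x:B|P. F x - G x) = 0" if "B \<in> ?G" for B
        using that eq sets_sigX_events by (subst diff) auto
    qed (use A sigX_UNIV in auto)
    then show ?thesis using diff[of A] A sets_sigX_events by auto
  qed
  then have "AE x in P. CE UNIV F x = G x"
    using G by (intro sub.real_cond_exp_charact F' G') (auto simp: L2_N_iff measurable_N)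
  moreover have "AE x in P. CE UNIV F x = F x"
    using F by (intro sub.real_cond_exp_F_meas F') (auto simp: L2_N_iff measurable_N)
  ultimately show "AE x in P. F x = G x" by eventually_elim simp
qed (use F G in auto)

text \<open>The squared norms increase and are bounded, and their differences are the squared
  distances of the conditional expectations, so these form a Cauchy sequence. The limit is
  \<open>F\<close> because it has the same integrals over cylinder events.\<close>

lemma CE_tendsto:
  assumes F: "F \<in> L2_space N"
  shows "(\<lambda>n. L2_norm N (\<lambda>x. CE {..<n} F x - F x)) \<longlonglongrightarrow> 0"
proof -
  define a where "a n = (L2_norm N (CE {..<n} F))\<^sup>2" for n
  have S: "CE {..<n} F \<in> L2_space N" for n by (rule CE_L2[OF F])
  have "incseq a" unfolding a_def by (intro incseq_SucI norm_CE_mono F) auto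
  moreover have "a n \<le> (L2_norm N F)\<^sup>2" for n unfolding a_def by (rule norm_CE_le[OF F])
  ultimately obtain l where "a \<longlonglongrightarrow> l" using incseq_convergent by blast
  then have "Cauchy a" by (rule LIMSEQ_imp_Cauchy)
  have dist: "(L2_norm N (\<lambda>x. CE {..<m} F x - CE {..<n} F x))\<^sup>2 = \<bar>a m - a n\<bar>" for m n
  proof (cases "n \<le> m")
    case True
    then show ?thesis using norm_CE_diff[OF F, of "{..<n}" "{..<m}"] norm_CE_mono[OF F, of "{..<n}" "{..<m}"]
      by (simp add: a_def)
  next
    case False
    then show ?thesis using norm_CE_diff[OF F, of "{..<m}" "{..<n}"] norm_CE_mono[OF F, of "{..<m}" "{..<n}"]
      by (simp add: a_def L2_norm_minus_commute[of N "CE {..<m} F"])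
  qed
  have "\<exists>G\<in>L2_space N. (\<lambda>n. L2_norm N (\<lambda>x. CE {..<n} F x - G x)) \<longlonglongrightarrow> 0"
  proof (rule L2_complete[OF prob_space_N S])
    fix e :: real assume e: "e > 0"
    then obtain n0 where n0: "\<And>m n. m \<ge> n0 \<Longrightarrow> n \<ge> n0 \<Longrightarrow> \<bar>a m - a n\<bar> < e\<^sup>2"
      using \<open>Cauchy a\<close> unfolding Cauchy_def dist_real_def by (metis zero_less_power)
    have "L2_norm N (\<lambda>x. CE {..<m} F x - CE {..<n} F x) < e" if "m \<ge> n0" "n \<ge> n0" for m n
      by (rule power2_less_imp_less) (use n0[OF that] e in \<open>simp_all add: dist\<close>)
    then show "\<exists>n0. \<forall>m\<ge>n0. \<forall>n\<ge>n0. L2_norm N (\<lambda>x. CE {..<m} F x - CE {..<n} F x) < e" by blast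
  qed
  then obtain G where G: "G \<in> L2_space N"
    and lim: "(\<lambda>n. L2_norm N (\<lambda>x. CE {..<n} F x - G x)) \<longlonglongrightarrow> 0" by blast
  have "AE x in N. F x = G x"
  proof (rule AE_eqI_integrals_cylinder[OF F G])
    fix A m assume A: "A \<in> sets (sigX P E X {..<m})"
    have ind: "(\<lambda>x. indicator A x :: real) \<in> L2_space N"
    proof -
      have "(\<lambda>x. indicator A x :: real) \<in> borel_measurable N"
        by (rule measurable_sigX_N[OF borel_measurable_indicator[OF A]])
      moreover have "(\<lambda>x. (indicator A x :: real)\<^sup>2) = indicator A"
        by (auto simp: indicator_def fun_eq_iff)
      moreover have "A \<in> events" using A sets_sigX_events by auto
      ultimately show ?thesis by (auto simp: L2_N_iff emeasure_eq_measure)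
    qed
    have inner: "L2_inner N H (indicator A) = (LINT x:A|P. H x)" if "H \<in> L2_space N" for H
      using L2_inner_N(1)[OF that ind] by (simp add: set_lebesgue_integral_def mult.commute)
    have "(\<lambda>n. L2_inner N (CE {..<n} F) (indicator A)) \<longlonglongrightarrow> L2_inner N G (indicator A)"
      by (rule L2_inner_tendsto[OF S G ind lim])
    \<comment> \<open>From \<open>n = m\<close> on, \<open>A\<close> belongs to the conditioning
      sigma-algebra and the sequence is constant.\<close>
    moreover have "(\<lambda>n. L2_inner N (CE {..<n} F) (indicator A)) \<longlonglongrightarrow> L2_inner N F (indicator A)"
    proof (rule tendsto_eventually, rule eventually_mono[OF eventually_ge_at_top[of m]])
      fix n assume "n \<ge> m"
      then have "A \<in> sets (sigX P E X {..<n})" using A sets_sigX_mono[of "{..<m}" "{..<n}"] by auto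
      then show "L2_inner N (CE {..<n} F) (indicator A) = L2_inner N F (indicator A)"
        using sub.real_cond_exp_intA[OF L2_N_integrable[OF F]] by (simp add: inner S F)
    qed
    ultimately show "(LINT x:A|P. F x) = (LINT x:A|P. G x)"
      using LIMSEQ_unique by (simp add: inner F G) blast
  qed
  then have "L2_norm N (\<lambda>x. CE {..<n} F x - F x) = L2_norm N (\<lambda>x. CE {..<n} F x - G x)" for n
    using S F G by (intro L2_norm_cong_AE) auto
  then show ?thesis using lim by simp
qed

lemma norm_CE_tendsto:
  assumes F: "F \<in> L2_space N"
  shows "(\<lambda>n. (L2_norm N (CE {..<n} F))\<^sup>2) \<longlonglongrightarrow> (L2_norm N F)\<^sup>2"
proof -
  have "(\<lambda>n. (L2_norm N F)\<^sup>2 - (L2_norm N (\<lambda>x. CE {..<n} F x - F x))\<^sup>2) \<longlonglongrightarrow> (L2_norm N F)\<^sup>2 - 0\<^sup>2"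
    by (intro tendsto_diff tendsto_const tendsto_power CE_tendsto F)
  then show ?thesis
    by (simp add: L2_norm_minus_commute[of N "CE _ F" F] norm_diff_CE[OF F])
qed

section \<open>Algebra of the Hoeffding components\<close>

lemma hoeff_L2:
  assumes "F \<in> L2_space N"
  shows "hoeff M F \<in> L2_space N"
  unfolding hoeffding_component_def by (intro L2_space_sum L2_space_cmult CE_L2 assms)

lemma hoeff_sym:
  assumes F: "F \<in> L2_space N" and G: "G \<in> L2_space N"
  shows "L2_inner N (hoeff M F) G = L2_inner N F (hoeff M G)"
proof -
  have "L2_inner N (hoeff M F) G = (\<Sum>K\<in>Pow M. (-1) ^ (card M - card K) * L2_inner N (CE K F) G)"
    unfolding hoeffding_component_def
    by (subst L2_inner_sum_left) (auto intro: CE_L2 F G simp: L2_inner_cmult_left)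
  also have "\<dots> = (\<Sum>K\<in>Pow M. (-1) ^ (card M - card K) * L2_inner N F (CE K G))"
    by (simp add: CE_sym[OF F G])
  also have "\<dots> = L2_inner N F (hoeff M G)"
    unfolding hoeffding_component_def
    by (subst L2_inner_sum_right) (auto intro: CE_L2 F G simp: L2_inner_cmult_right)
  finally show ?thesis .
qed

text \<open>By \<open>CE_CE\<close>, applying \<open>CE K\<close> replaces each index set
  \<open>L\<close> by \<open>K \<inter> L\<close>. An element of \<open>M\<close> outside
  \<open>K\<close> then becomes invisible and the alternating sum cancels.\<close>

lemma CE_hoeff:
  assumes F: "F \<in> L2_space N" and M: "finite M"
  shows "AE x in N. CE K (hoeff M F) x = (if M \<subseteq> K then 1 else 0) * hoeff M F x"
proof -
  have "AE x in P. CE K (hoeff M F) x = (\<Sum>L\<in>Pow M. CE K (\<lambda>x. (-1) ^ (card M - card L) * CE L F x) x)"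
    unfolding hoeffding_component_def
    by (rule sub.real_cond_exp_sum) (auto intro: L2_N_integrable CE_L2 F)
  then have 1: "AE x in N. CE K (hoeff M F) x = (\<Sum>L\<in>Pow M. CE K (\<lambda>x. (-1) ^ (card M - card L) * CE L F x) x)"
    by (rule AE_N_eqI) (intro CE_measurable_N borel_measurable_sum)+
  have "AE x in N. CE K (\<lambda>x. (-1) ^ (card M - card L) * CE L F x) x = (-1) ^ (card M - card L) * CE (K \<inter> L) F x" for L
  proof -
    have "AE x in N. CE K (\<lambda>x. (-1) ^ (card M - card L) * CE L F x) x = (-1) ^ (card M - card L) * CE K (CE L F) x"
      by (rule AE_N_eqI[OF sub.real_cond_exp_cmult])
         (intro L2_N_integrable CE_L2 F CE_measurable_N borel_measurable_times borel_measurable_const)+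
    with CE_CE[OF F, of K L] show ?thesis by eventually_elim simp
  qed
  then have "AE x in N. \<forall>L\<in>Pow M. CE K (\<lambda>x. (-1) ^ (card M - card L) * CE L F x) x = (-1) ^ (card M - card L) * CE (K \<inter> L) F x"
    using M by (simp add: AE_finite_all)
  with 1 show ?thesis
  proof eventually_elim
    case (elim x)
    have *: "CE K (hoeff M F) x = (\<Sum>L\<in>Pow M. (-1) ^ (card M - card L) * CE (K \<inter> L) F x)"
      unfolding elim(1) using elim(2) by (intro sum.cong) auto
    show ?case
    proof (cases "M \<subseteq> K")
      case True
      then have "K \<inter> L = L" if "L \<in> Pow M" for L using that by auto
      then show ?thesis unfolding * using True by (simp add: hoeffding_component_def)
    next
      case False
      then obtain y where y: "y \<in> M" "y \<notin> K" by auto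
      have "(\<Sum>L\<in>Pow M. (-1) ^ (card M - card L) * CE (K \<inter> L) F x) = 0"
        using y by (intro alternating_sum_Pow_eq_0[OF M y(1)]) simp
      then show ?thesis using * False by simp
    qed
  qed
qed

text \<open>After \<open>CE_hoeff\<close> only the sets between \<open>M\<close> and
  \<open>L\<close> contribute. For \<open>L = M\<close> that is one term; for \<open>M\<close>
  strictly inside \<open>L\<close> an element of \<open>L - M\<close> makes the signs
  cancel.\<close>

lemma hoeff_hoeff:
  assumes F: "F \<in> L2_space N" and L: "finite L" and M: "finite M"
  shows "AE x in N. hoeff L (hoeff M F) x = (if L = M then hoeff L F x else 0)"
proof -
  have "AE x in N. \<forall>K\<in>Pow L. CE K (hoeff M F) x = (if M \<subseteq> K then 1 else 0) * hoeff M F x"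
    using CE_hoeff[OF F M] L by (simp add: AE_finite_all)
  then show ?thesis
  proof eventually_elim
    case (elim x)
    have *: "hoeff L (hoeff M F) x
        = (\<Sum>K\<in>Pow L. (-1) ^ (card L - card K) * ((if M \<subseteq> K then 1 else 0) * hoeff M F x))"
      unfolding hoeffding_component_def[of _ _ _ "hoeff M F"] using elim by (intro sum.cong) auto
    consider "L = M" | "\<not> M \<subseteq> L" | y where "M \<subseteq> L" "y \<in> L" "y \<notin> M" by blast
    then show ?case
    proof cases
      case 1
      have "(\<Sum>K\<in>Pow L. (-1) ^ (card L - card K) * ((if M \<subseteq> K then 1 else 0) * hoeff M F x))
          = (\<Sum>K\<in>{L}. (-1) ^ (card L - card K) * ((if M \<subseteq> K then 1 else 0) * hoeff M F x))"
        using 1 L by (intro sum.mono_neutral_right) auto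
      then show ?thesis using * 1 by simp
    next
      case 2
      then have "\<not> M \<subseteq> K" if "K \<in> Pow L" for K using that by auto
      then show ?thesis using * 2 by auto
    next
      case 3
      then have "(\<Sum>K\<in>Pow L. (-1) ^ (card L - card K) * ((if M \<subseteq> K then 1 else 0) * hoeff M F x)) = 0"
        by (intro alternating_sum_Pow_eq_0[OF L 3(2)]) (auto simp: subset_insert)
      then show ?thesis using * 3 by auto
    qed
  qed
qed

text \<open>Moebius inversion on the subsets of \<open>K\<close>. As an identity between finite sums
  it holds at every point, not merely almost everywhere.\<close>

lemma CE_eq_sum_hoeff:
  assumes K: "finite K"
  shows "CE K F x = (\<Sum>M\<in>Pow K. hoeff M F x)"
proof -
  \<comment> \<open>The sign inside \<open>g\<close> fits the self-inverse form of
    inclusion-exclusion; \<open>(-1) ^ card M * g M\<close> is then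
    \<open>hoeff M F\<close>.\<close>
  define g where "g S = (\<Sum>T\<in>Pow S. (-1) ^ card T * CE T F x)" for S
  have "CE K F x = (\<Sum>M\<in>Pow K. (-1) ^ card M * g M)"
    by (rule inclusion_exclusion_symmetric[OF g_def K])
  also have "\<dots> = (\<Sum>M\<in>Pow K. hoeff M F x)"
  proof (rule sum.cong)
    fix M assume "M \<in> Pow K"
    then have M: "finite M" using K by (auto intro: finite_subset)
    have "(-1) ^ card M * g M = (\<Sum>T\<in>Pow M. (-1) ^ (card M + card T) * CE T F x)"
      by (simp add: g_def sum_distrib_left power_add mult.assoc)
    also have "\<dots> = hoeff M F x"
      unfolding hoeffding_component_def using M
      by (intro sum.cong) (auto simp: card_mono neg_one_power_add_eq_neg_one_power_diff)
    finally show "(-1) ^ card M * g M = hoeff M F x" .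
  qed simp
  finally show ?thesis .
qed

lemma norm_CE_eq_sum_hoeff:
  assumes F: "F \<in> L2_space N" and K: "finite K"
  shows "(L2_norm N (CE K F))\<^sup>2 = (\<Sum>M\<in>Pow K. (L2_norm N (hoeff M F))\<^sup>2)"
proof -
  have "(L2_norm N (CE K F))\<^sup>2 = L2_inner N (CE K F) F"
    by (simp add: L2_norm_square inner_CE[OF F F])
  also have "\<dots> = (\<Sum>M\<in>Pow K. L2_inner N (hoeff M F) F)"
    unfolding CE_eq_sum_hoeff[OF K] by (rule L2_inner_sum_left) (intro hoeff_L2 F)+
  also have "\<dots> = (\<Sum>M\<in>Pow K. (L2_norm N (hoeff M F))\<^sup>2)"
  proof (rule sum.cong)
    fix M assume "M \<in> Pow K"
    then have M: "finite M" using K by (auto intro: finite_subset)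
    have "(L2_norm N (hoeff M F))\<^sup>2 = L2_inner N (hoeff M (hoeff M F)) F"
      by (simp add: L2_norm_square hoeff_sym hoeff_L2 F)
    also have "\<dots> = L2_inner N (hoeff M F) F"
      using hoeff_hoeff[OF F M M] by (intro L2_inner_cong_AE) (auto intro: hoeff_L2 F)
    finally show "L2_inner N (hoeff M F) F = (L2_norm N (hoeff M F))\<^sup>2" ..
  qed simp
  finally show ?thesis .
qed

lemma finite_subset_Pow_lessThan:
  assumes "finite A" "A \<subseteq> {M. finite M}"
  obtains n :: nat where "A \<subseteq> Pow {..<n}"
proof -
  have "finite (\<Union>A)" using assms by auto
  then obtain n where "\<Union>A \<subseteq> {..<n}"
    by (metis finite_nat_iff_bounded)
  then show ?thesis using that by blast
qed

text \<open>The families \<open>Pow {..<n}\<close> are cofinal among finite families of finite sets.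
  Unordered sums over \<open>M\<close> can thus be evaluated along the first \<open>n\<close>
  variables.\<close>

lemma filterlim_Pow_lessThan:
  "filterlim (\<lambda>n::nat. Pow {..<n}) (finite_subsets_at_top {M. finite M}) sequentially"
proof (rule filterlim_finite_subsets_at_top[THEN iffD2], intro allI impI)
  fix A :: "nat set set" assume A: "finite A \<and> A \<subseteq> {M. finite M}"
  then obtain n where n: "A \<subseteq> Pow {..<n}" using finite_subset_Pow_lessThan by blast
  have "A \<subseteq> Pow {..<m} \<and> Pow {..<m} \<subseteq> {M. finite M}" if "m \<ge> n" for m
    using n that by (auto intro: finite_subset dest: order_trans[of _ "{..<n}" "{..<m}"])
  then show "\<forall>\<^sub>F m in sequentially. finite (Pow {..<m}) \<and> A \<subseteq> Pow {..<m} \<and> Pow {..<m} \<subseteq> {M. finite M}"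
    by (auto simp: eventually_at_top_linorder)
qed

sublocale hoeffding: L2_orthogonal_decomposition N "\<lambda>M F. hoeff M F" "{M. finite M}"
proof -
  interpret N: prob_space N by (rule prob_space_N)
  show "L2_orthogonal_decomposition N (\<lambda>M F. hoeff M F) {M. finite M}"
  proof (unfold_locales, goal_cases)
    case (1 M F)
    then show ?case by (intro hoeff_L2)
  next
    case (2 M F G)
    then show ?case by (intro hoeff_sym)
  next
    case (3 L M F)
    then show ?case by (intro hoeff_hoeff) auto
  next
    case (4 F)
    let ?f = "\<lambda>M. (L2_norm N (hoeff M F))\<^sup>2"
    have bound: "sum ?f A \<le> (L2_norm N F)\<^sup>2" if A: "finite A" "A \<subseteq> {M. finite M}" for A
    proof -
      obtain n where "A \<subseteq> Pow {..<n}" using finite_subset_Pow_lessThan[OF A] .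
      then have "sum ?f A \<le> sum ?f (Pow {..<n})" by (intro sum_mono2) auto
      also have "\<dots> \<le> (L2_norm N F)\<^sup>2"
        using norm_CE_le[OF 4, of "{..<n}"] by (simp only: norm_CE_eq_sum_hoeff[OF 4 finite_lessThan])
      finally show ?thesis .
    qed
    \<comment> \<open>Summability comes first, from bounded partial sums; the value is then found
      along the cofinal sequence, where the partial sums are squared norms of
      \<open>CE {..<n} F\<close>.\<close>
    have "?f summable_on {M. finite M}"
      by (rule nonneg_bounded_partial_sums_imp_summable_on[of _ _ "(L2_norm N F)\<^sup>2"])
         (auto intro!: eventually_finite_subsets_at_top_weakI bound)
    then obtain s where s: "(?f has_sum s) {M. finite M}" by (auto simp: summable_on_def)
    have "(\<lambda>n. sum ?f (Pow {..<n})) \<longlonglongrightarrow> s"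
      using s unfolding has_sum_def by (rule filterlim_compose[OF _ filterlim_Pow_lessThan])
    moreover have "(\<lambda>n. sum ?f (Pow {..<n})) \<longlonglongrightarrow> (L2_norm N F)\<^sup>2"
      using norm_CE_tendsto[OF 4] by (simp add: norm_CE_eq_sum_hoeff[OF 4])
    ultimately show ?case using s LIMSEQ_unique by blast
  qed
qed

end

section \<open>Malliavin operators\<close>

context independent_sequence
begin

abbreviation "D k F \<equiv> \<lambda>\<omega>. malliavin_D P E X F (k, \<omega>)"
abbreviation "w1 \<equiv> \<lambda>M::nat set. real (card M)"
abbreviation "w2 \<equiv> \<lambda>M::nat set. (real (card M))\<^sup>2"

lemma D_eq: "D k F = (\<lambda>\<omega>. F \<omega> - CE (- {k}) F \<omega>)"
  by (simp add: malliavin_D_def)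

lemma D_L2: "F \<in> L2_space N \<Longrightarrow> D k F \<in> L2_space N"
  unfolding D_eq by (intro L2_space_diff CE_L2)

text \<open>Conditioning on all variables but \<open>k\<close> makes \<open>k\<close> invisible: for
  \<open>k\<close> in \<open>M\<close> the component of \<open>CE (- {k}) F\<close> cancels,
  otherwise it is that of \<open>F\<close>.\<close>

lemma hoeff_D:
  assumes F: "F \<in> L2_space N" and M: "finite M"
  shows "AE x in N. hoeff M (D k F) x = (if k \<in> M then 1 else 0) * hoeff M F x"
proof -
  have "AE x in N. \<forall>S\<in>Pow M. CE S (CE (- {k}) F) x = CE (S \<inter> - {k}) F x"
    using CE_CE[OF F] M by (simp add: AE_finite_all)
  moreover have "AE x in N. hoeff M (D k F) x = hoeff M F x - hoeff M (CE (- {k}) F) x"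
    unfolding D_eq using M by (intro hoeffding.component_diff F CE_L2) auto
  ultimately show ?thesis
  proof eventually_elim
    case (elim x)
    have *: "hoeff M (CE (- {k}) F) x = (\<Sum>S\<in>Pow M. (-1) ^ (card M - card S) * CE (S \<inter> - {k}) F x)"
      unfolding hoeffding_component_def[of _ _ _ "CE (- {k}) F"] using elim(1) by (intro sum.cong) auto
    show ?case
    proof (cases "k \<in> M")
      case True
      then have "(\<Sum>S\<in>Pow M. (-1) ^ (card M - card S) * CE (S \<inter> - {k}) F x) = 0"
        by (intro alternating_sum_Pow_eq_0[OF M True]) simp
      then show ?thesis using elim(2) * True by simp
    next
      case False
      then have "S \<inter> - {k} = S" if "S \<in> Pow M" for S using that by auto
      then have "hoeff M (CE (- {k}) F) x = hoeff M F x"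
        unfolding * by (simp add: hoeffding_component_def)
      then show ?thesis using elim(2) False by simp
    qed
  qed
qed

lemma hoeff_CE:
  assumes F: "F \<in> L2_space N" and M: "finite M" and K: "finite K"
  shows "AE x in N. hoeff M (CE K F) x = (if M \<subseteq> K then 1 else 0) * hoeff M F x"
proof -
  have *: "CE K F = (\<lambda>x. \<Sum>L\<in>Pow K. 1 * hoeff L F x)" using CE_eq_sum_hoeff[OF K] by auto
  have "Pow K \<subseteq> {M. finite M}" using K by (auto intro: finite_subset)
  from hoeffding.component_combination[OF this _ F, of M "\<lambda>_. 1"] show ?thesis
    unfolding * using M K by simp
qed

lemma inner_D_has_sum:
  assumes F: "F \<in> L2_space N" and G: "G \<in> L2_space N"
  shows "((\<lambda>M. (if k \<in> M then 1 else 0) * L2_inner N (hoeff M F) (hoeff M G)) has_sum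
    L2_inner N (D k F) (D k G)) {M. finite M}"
proof -
  have "L2_inner N (hoeff M (D k F)) (hoeff M (D k G))
      = (if k \<in> M then 1 else 0) * L2_inner N (hoeff M F) (hoeff M G)" if "finite M" for M
  proof -
    have "L2_inner N (hoeff M (D k F)) (hoeff M (D k G))
        = L2_inner N (\<lambda>x. (if k \<in> M then 1 else 0) * hoeff M F x) (\<lambda>x. (if k \<in> M then 1 else 0) * hoeff M G x)"
      by (rule L2_inner_cong_AE[OF hoeff_D[OF F that] hoeff_D[OF G that]])
         (intro hoeff_L2 D_L2 L2_space_cmult F G)+
    then show ?thesis by (simp add: L2_inner_cmult_left L2_inner_cmult_right)
  qed
  then show ?thesis
    by (intro has_sum_cong[THEN iffD1, OF _ hoeffding.inner_has_sum[OF D_L2[OF F] D_L2[OF G]]]) simp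
qed

text \<open>The Dirichlet form, that is, the inner product of \<open>D F\<close> and
  \<open>D G\<close> in components. An infinite sum that does not converge is 0 by default, so it is
  evaluated only on the domain with weight \<open>card\<close>.\<close>

definition energy :: "('a \<Rightarrow> real) \<Rightarrow> ('a \<Rightarrow> real) \<Rightarrow> real" where
  "energy F G = (\<Sum>\<^sub>\<infinity>M\<in>{M. finite M}. real (card M) * L2_inner N (hoeff M F) (hoeff M G))"

lemma has_sum_card:
  fixes a :: real
  assumes "finite M"
  shows "((\<lambda>k. (if k \<in> M then 1 else 0) * a) has_sum real (card M) * a) UNIV"
  using assms by (intro has_sum_finite_neutralI[of M]) auto

text \<open>A double sum over the pairs with \<open>k \<in> M\<close>: summing over \<open>k\<close>
  first produces the factor \<open>card M\<close>, summing over \<open>M\<close> first produces the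
  inner product of \<open>D k F\<close> and \<open>D k G\<close>.\<close>

lemma energy_has_sum:
  assumes F: "F \<in> hoeffding.weight_dom w1" and G: "G \<in> hoeffding.weight_dom w1"
  shows "((\<lambda>M. real (card M) * L2_inner N (hoeff M F) (hoeff M G)) has_sum energy F G) {M. finite M}"
    and "((\<lambda>k. L2_inner N (D k F) (D k G)) has_sum energy F G) UNIV"
proof -
  let ?I = "{M::nat set. finite M}"
  let ?f = "\<lambda>(M, k). (if k \<in> M then 1 else 0) * L2_inner N (hoeff M F) (hoeff M G)"
  \<comment> \<open>A majorant that permits the exchange of sums; the mixed inner product is at most
    the sum of the two squared norms.\<close>
  let ?g = "\<lambda>(M, k). (if k \<in> M then 1 else 0) * ((L2_norm N (hoeff M F))\<^sup>2 + (L2_norm N (hoeff M G))\<^sup>2)"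
  have FG: "F \<in> L2_space N" "G \<in> L2_space N" using F G by (auto dest: hoeffding.weight_domD)
  have "?g summable_on ?I \<times> UNIV"
  proof (rule summable_on_SigmaI)
    show "((\<lambda>k. ?g (M, k)) has_sum real (card M) * ((L2_norm N (hoeff M F))\<^sup>2 + (L2_norm N (hoeff M G))\<^sup>2)) UNIV"
      if "M \<in> ?I" for M using has_sum_card[of M] that by simp
    show "(\<lambda>M. real (card M) * ((L2_norm N (hoeff M F))\<^sup>2 + (L2_norm N (hoeff M G))\<^sup>2)) summable_on ?I"
      using F G unfolding distrib_left by (intro summable_on_add) (auto simp: hoeffding.weight_dom_def)
  qed auto
  moreover have "norm (?f z) \<le> ?g z" for z
  proof -
    obtain M k where z: "z = (M, k)" by (cases z)
    have "\<bar>L2_inner N (hoeff M F) (hoeff M G)\<bar> \<le> L2_norm N (hoeff M F) * L2_norm N (hoeff M G)"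
      by (intro L2_Cauchy_Schwarz hoeff_L2 FG)
    also have "\<dots> \<le> (L2_norm N (hoeff M F))\<^sup>2 + (L2_norm N (hoeff M G))\<^sup>2"
    proof -
      have "0 \<le> (L2_norm N (hoeff M F) - L2_norm N (hoeff M G))\<^sup>2" by simp
      moreover have "0 \<le> L2_norm N (hoeff M F) * L2_norm N (hoeff M G)" by simp
      ultimately show ?thesis unfolding power2_diff by linarith
    qed
    finally show ?thesis by (simp add: z)
  qed
  ultimately have "(\<lambda>z. norm (?f z)) summable_on ?I \<times> UNIV"
    by (rule Infinite_Sum.abs_summable_on_comparison_test')
  then have sum: "?f summable_on ?I \<times> UNIV" by (rule abs_summable_summable)
  then have f: "(?f has_sum infsum ?f (?I \<times> UNIV)) (?I \<times> UNIV)" by (rule has_sum_infsum)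
  have M: "((\<lambda>M. real (card M) * L2_inner N (hoeff M F) (hoeff M G)) has_sum infsum ?f (?I \<times> UNIV)) ?I"
    by (rule has_sum_SigmaD[OF f]) (use has_sum_card in auto)
  then have e: "infsum ?f (?I \<times> UNIV) = energy F G" unfolding energy_def by (simp add: infsumI)
  show "((\<lambda>M. real (card M) * L2_inner N (hoeff M F) (hoeff M G)) has_sum energy F G) ?I"
    using M by (simp add: e)
  have "((\<lambda>(k, M). ?f (M, k)) has_sum energy F G) (UNIV \<times> ?I)"
    using f unfolding e by (subst (asm) has_sum_swap)
  then show "((\<lambda>k. L2_inner N (D k F) (D k G)) has_sum energy F G) UNIV"
    by (rule has_sum_SigmaD) (use inner_D_has_sum[OF FG] in auto)
qed

text \<open>Tonelli over the countable index. Computing with \<open>nn_integral\<close> gives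
  integrability and the value at the same time.\<close>

lemma kappa_L2:
  assumes U: "\<And>k. (\<lambda>\<omega>. U (k, \<omega>)) \<in> L2_space N"
    and sum: "((\<lambda>k. (L2_norm N (\<lambda>\<omega>. U (k, \<omega>)))\<^sup>2) has_sum s) UNIV"
  shows "U \<in> L2_space (kappa_PF P E X)" "(L2_norm (kappa_PF P E X) U)\<^sup>2 = s"
proof -
  let ?K = "kappa_PF P E X"
  have meas: "U \<in> borel_measurable ?K"
    unfolding kappa_PF_def using U by (intro measurable_pair_measure_countable1) auto
  have sums: "(\<lambda>k. (L2_norm N (\<lambda>\<omega>. U (k, \<omega>)))\<^sup>2) sums s"
    using sum by (rule has_sum_imp_sums)
  have s: "0 \<le> s" using sum by (rule has_sum_nonneg) simp
  have "(\<integral>\<^sup>+z. ennreal ((U z)\<^sup>2) \<partial>?K) = (\<integral>\<^sup>+k. (\<integral>\<^sup>+\<omega>. ennreal ((U (k, \<omega>))\<^sup>2) \<partial>N) \<partial>count_space UNIV)"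
    using meas unfolding kappa_PF_def by (intro hoeffding.nn_integral_fst[symmetric]) measurable
  also have "\<dots> = (\<Sum>k. ennreal ((L2_norm N (\<lambda>\<omega>. U (k, \<omega>)))\<^sup>2))"
    by (simp add: nn_integral_square_L2_norm[OF U] nn_integral_count_space_nat)
  also have "\<dots> = ennreal s"
    using sums by (intro suminf_ennreal_eq) auto
  finally have nn: "(\<integral>\<^sup>+z. ennreal ((U z)\<^sup>2) \<partial>?K) = ennreal s" .
  then have "integrable ?K (\<lambda>z. (U z)\<^sup>2)"
    using meas by (intro integrableI_bounded) auto
  then show U': "U \<in> L2_space ?K" using meas by (simp add: L2_space_def)
  show "(L2_norm ?K U)\<^sup>2 = s"
    using nn_integral_square_L2_norm[OF U'] s unfolding nn by simp
qed

lemma malliavin_D_kappa: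
  assumes F: "F \<in> hoeffding.weight_dom w1"
  shows "malliavin_D P E X F \<in> L2_space (kappa_PF P E X)"
    and "(L2_norm (kappa_PF P E X) (malliavin_D P E X F))\<^sup>2 = energy F F"
  using kappa_L2[of "malliavin_D P E X F" "energy F F"] energy_has_sum(2)[OF F F]
    D_L2[OF hoeffding.weight_domD[OF F]]
  by (simp_all add: L2_norm_square)

section \<open>The domain of the closed operator \<open>D\<close>\<close>

lemma weight_dom_cong_AE:
  assumes F: "F \<in> hoeffding.weight_dom w" and G: "G \<in> L2_space N" and eq: "AE x in N. F x = G x"
  shows "G \<in> hoeffding.weight_dom w"
proof -
  have F': "F \<in> L2_space N" using F by (rule hoeffding.weight_domD)
  have "L2_norm N (hoeff M F) = L2_norm N (hoeff M G)" if "finite M" for M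
    using hoeffding.component_cong[OF _ F' G eq] that by (intro L2_norm_cong_AE hoeff_L2 F' G) auto
  then have "(\<lambda>M. w M * (L2_norm N (hoeff M F))\<^sup>2) summable_on {M. finite M} \<longleftrightarrow>
      (\<lambda>M. w M * (L2_norm N (hoeff M G))\<^sup>2) summable_on {M. finite M}"
    by (intro summable_on_cong) simp
  then show ?thesis using F G by (simp add: hoeffding.weight_dom_def)
qed

lemma CE_weight_dom:
  assumes F: "F \<in> L2_space N" and K: "finite K"
  shows "CE K F \<in> hoeffding.weight_dom w"
proof -
  have "CE K F = (\<lambda>x. \<Sum>L\<in>Pow K. 1 * hoeff L F x)" using CE_eq_sum_hoeff[OF K] by auto
  then show ?thesis
    using hoeffding.combination_weight_dom[of "Pow K" F "\<lambda>_. 1" w] F K finite_subset[OF _ K] by auto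
qed

text \<open>A function of the first \<open>n\<close> variables is almost everywhere its own
  conditional expectation, hence a finite combination of components.\<close>

lemma malliavin_core_weight_dom:
  assumes "\<Phi> \<in> malliavin_core P E X"
  shows "\<Phi> \<in> hoeffding.weight_dom w"
proof -
  obtain n where \<Phi>: "\<Phi> \<in> L2_space N" and meas: "\<Phi> \<in> borel_measurable (sigX P E X {..<n})"
    using assms by (auto simp: malliavin_core_def)
  have "AE x in N. CE {..<n} \<Phi> x = \<Phi> x"
    using \<Phi> meas by (intro AE_N_eqI[OF sub.real_cond_exp_F_meas]) (auto intro: L2_N_integrable CE_measurable_N)
  then show ?thesis
    by (rule weight_dom_cong_AE[OF CE_weight_dom[OF \<Phi>] \<Phi>, rotated]) simp
qed

lemma L2_norm_hoeff_tendsto: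
  assumes \<Phi>: "\<And>n. \<Phi> n \<in> L2_space N" and F: "F \<in> L2_space N" and M: "finite M"
    and lim: "(\<lambda>n. L2_norm N (\<lambda>x. \<Phi> n x - F x)) \<longlonglongrightarrow> 0"
  shows "(\<lambda>n. L2_norm N (hoeff M (\<Phi> n))) \<longlonglongrightarrow> L2_norm N (hoeff M F)"
proof -
  have "norm (L2_norm N (hoeff M (\<Phi> n)) - L2_norm N (hoeff M F)) \<le> L2_norm N (\<lambda>x. \<Phi> n x - F x)" for n
  proof -
    let ?a = "hoeff M (\<Phi> n)" and ?b = "hoeff M F"
    have a: "?a \<in> L2_space N" and b: "?b \<in> L2_space N" by (intro hoeff_L2 \<Phi> F)+
    have "L2_norm N (\<lambda>x. ?a x - ?b x) = L2_norm N (hoeff M (\<lambda>x. \<Phi> n x - F x))"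
      using hoeffding.component_diff[of M "\<Phi> n" F] M \<Phi> F
      by (intro L2_norm_cong_AE) (auto intro: hoeff_L2 elim!: eventually_mono)
    also have "\<dots> \<le> L2_norm N (\<lambda>x. \<Phi> n x - F x)"
      using M by (intro hoeffding.norm_component_le L2_space_diff \<Phi> F) auto
    \<comment> \<open>The reverse triangle inequality, with the zero function as third
      point.\<close>
    finally show ?thesis
      using L2_norm_diff_triangle[OF a b L2_space_zero] L2_norm_diff_triangle[OF b a L2_space_zero]
      by (simp add: L2_norm_minus_commute[of N ?b ?a])
  qed
  then have "(\<lambda>n. L2_norm N (hoeff M (\<Phi> n)) - L2_norm N (hoeff M F)) \<longlonglongrightarrow> 0"
    using lim by (intro Lim_null_comparison[OF _ lim]) simp
  then show ?thesis by (rule LIM_zero_cancel)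
qed

text \<open>Lower semicontinuity of the energy: each finite partial sum is continuous along the
  approximating sequence and stays below the squared norm of the limit \<open>U\<close> of the
  derivatives.\<close>

lemma malliavin_dom_subset: "malliavin_dom P E X \<subseteq> hoeffding.weight_dom w1"
proof
  fix F assume "F \<in> malliavin_dom P E X"
  then obtain U \<Phi> where F: "F \<in> L2_space N" and U: "U \<in> L2_space (kappa_PF P E X)"
    and \<Phi>: "\<And>n. \<Phi> n \<in> malliavin_core P E X"
    and lim: "(\<lambda>n. L2_norm N (\<lambda>\<omega>. \<Phi> n \<omega> - F \<omega>)) \<longlonglongrightarrow> 0"
    and D_lim: "(\<lambda>n. L2_norm (kappa_PF P E X) (\<lambda>z. malliavin_D P E X (\<Phi> n) z - U z)) \<longlonglongrightarrow> 0"
    by (auto simp: malliavin_dom_def malliavin_graph_def)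
  let ?K = "kappa_PF P E X"
  have \<Phi>w: "\<Phi> n \<in> hoeffding.weight_dom w1" for n by (rule malliavin_core_weight_dom[OF \<Phi>])
  then have \<Phi>L: "\<Phi> n \<in> L2_space N" for n by (rule hoeffding.weight_domD)
  have "(\<Sum>M\<in>A. real (card M) * (L2_norm N (hoeff M F))\<^sup>2) \<le> (L2_norm ?K U)\<^sup>2"
    if A: "finite A" "A \<subseteq> {M. finite M}" for A
  proof (rule LIMSEQ_le)
    show "(\<lambda>n. \<Sum>M\<in>A. real (card M) * (L2_norm N (hoeff M (\<Phi> n)))\<^sup>2)
        \<longlonglongrightarrow> (\<Sum>M\<in>A. real (card M) * (L2_norm N (hoeff M F))\<^sup>2)"
      using A by (intro tendsto_sum tendsto_mult tendsto_const tendsto_power L2_norm_hoeff_tendsto \<Phi>L F lim) auto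
    have "(\<lambda>n. (L2_norm ?K (\<lambda>z. malliavin_D P E X (\<Phi> n) z - U z) + L2_norm ?K U)\<^sup>2) \<longlonglongrightarrow> (0 + L2_norm ?K U)\<^sup>2"
      by (intro tendsto_power tendsto_add D_lim tendsto_const)
    then show "(\<lambda>n. (L2_norm ?K (\<lambda>z. malliavin_D P E X (\<Phi> n) z - U z) + L2_norm ?K U)\<^sup>2) \<longlonglongrightarrow> (L2_norm ?K U)\<^sup>2"
      by simp
    have "(\<Sum>M\<in>A. real (card M) * (L2_norm N (hoeff M (\<Phi> n)))\<^sup>2)
        \<le> (L2_norm ?K (\<lambda>z. malliavin_D P E X (\<Phi> n) z - U z) + L2_norm ?K U)\<^sup>2" for n
    proof -
      let ?V = "malliavin_D P E X (\<Phi> n)"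
      have "(\<Sum>M\<in>A. real (card M) * (L2_norm N (hoeff M (\<Phi> n)))\<^sup>2) \<le> energy (\<Phi> n) (\<Phi> n)"
        using A energy_has_sum(1)[OF \<Phi>w \<Phi>w] unfolding L2_norm_square by (intro finite_sum_le_has_sum) auto
      also have "\<dots> = (L2_norm ?K ?V)\<^sup>2" by (rule malliavin_D_kappa(2)[OF \<Phi>w, symmetric])
      also have "\<dots> \<le> (L2_norm ?K (\<lambda>z. ?V z - U z) + L2_norm ?K U)\<^sup>2"
        using L2_norm_triangle[OF L2_space_diff[OF malliavin_D_kappa(1)[OF \<Phi>w] U] U]
        by (intro power_mono) auto
      finally show ?thesis .
    qed
    then show "\<exists>n0. \<forall>n\<ge>n0. (\<Sum>M\<in>A. real (card M) * (L2_norm N (hoeff M (\<Phi> n)))\<^sup>2)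
        \<le> (L2_norm ?K (\<lambda>z. malliavin_D P E X (\<Phi> n) z - U z) + L2_norm ?K U)\<^sup>2" by blast
  qed
  then have "(\<lambda>M. real (card M) * (L2_norm N (hoeff M F))\<^sup>2) summable_on {M. finite M}"
    by (intro nonneg_bounded_partial_sums_imp_summable_on[of _ _ "(L2_norm ?K U)\<^sup>2"]
        eventually_finite_subsets_at_top_weakI) auto
  then show "F \<in> hoeffding.weight_dom w1" using F by (simp add: hoeffding.weight_dom_def)
qed

text \<open>The approximants are \<open>CE {..<n} F\<close>. Their difference to \<open>F\<close>
  has exactly the components outside \<open>Pow {..<n}\<close>, so its energy is the tail of a
  convergent series.\<close>

lemma weight_dom_subset_malliavin_dom: "hoeffding.weight_dom w1 \<subseteq> malliavin_dom P E X"
proof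
  fix F assume Fw: "F \<in> hoeffding.weight_dom w1"
  then have F: "F \<in> L2_space N" by (rule hoeffding.weight_domD)
  let ?K = "kappa_PF P E X" and ?\<Phi> = "\<lambda>n::nat. CE {..<n} F"
  let ?b = "\<lambda>M. real (card M) * (L2_norm N (hoeff M F))\<^sup>2"
  have b: "(?b has_sum energy F F) {M. finite M}"
    using energy_has_sum(1)[OF Fw Fw] by (simp add: L2_norm_square)
  have core: "?\<Phi> n \<in> malliavin_core P E X" for n
    using CE_L2[OF F] by (auto simp: malliavin_core_def intro!: exI[of _ n])
  have norm: "(L2_norm ?K (\<lambda>z. malliavin_D P E X (?\<Phi> n) z - malliavin_D P E X F z))\<^sup>2
      = energy F F - sum ?b (Pow {..<n})" for n
  proof -
    define W where "W x = ?\<Phi> n x - F x" for x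
    have W: "W \<in> L2_space N" unfolding W_def by (intro L2_space_diff CE_L2 F)
    have norm_W: "(L2_norm N (hoeff M W))\<^sup>2 = (if M \<in> Pow {..<n} then 0 else (L2_norm N (hoeff M F))\<^sup>2)"
      if M: "finite M" for M
    proof -
      have "AE x in N. hoeff M W x = (if M \<subseteq> {..<n} then 0 else -1) * hoeff M F x"
        using hoeffding.component_diff[OF _ CE_L2[OF F] F, of M "{..<n}", folded W_def[abs_def], simplified, OF M]
          hoeff_CE[OF F M finite_lessThan, of n]
        by eventually_elim simp
      then have "L2_norm N (hoeff M W) = L2_norm N (\<lambda>x. (if M \<subseteq> {..<n} then 0 else -1) * hoeff M F x)"
        by (rule L2_norm_cong_AE) (intro hoeff_L2 W F L2_space_cmult)+
      then show ?thesis by (auto simp: L2_norm_cmult)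
    qed
    have diff: "((\<lambda>M. real (card M) * (L2_norm N (hoeff M W))\<^sup>2) has_sum energy F F - sum ?b (Pow {..<n})) {M. finite M}"
    proof -
      have "(?b has_sum (energy F F - sum ?b (Pow {..<n}))) ({M. finite M} - Pow {..<n})"
        by (rule has_sum_Diff[OF b]) (auto intro: finite_subset)
      then show ?thesis
        by (rule has_sum_cong_neutral[THEN iffD1, rotated -1]) (auto simp: norm_W)
    qed
    then have Ww: "W \<in> hoeffding.weight_dom w1"
      using W by (auto simp: hoeffding.weight_dom_def summable_on_def)
    have "energy W W = energy F F - sum ?b (Pow {..<n})"
      using has_sum_unique[OF diff] energy_has_sum(1)[OF Ww Ww] by (simp add: L2_norm_square)
    moreover have "L2_norm N (\<lambda>\<omega>. D k (?\<Phi> n) \<omega> - D k F \<omega>) = L2_norm N (D k W)" for k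
    proof (rule L2_norm_cong_AE)
      have "AE x in P. CE (- {k}) W x = CE (- {k}) (?\<Phi> n) x - CE (- {k}) F x"
        unfolding W_def[abs_def] by (intro sub.real_cond_exp_diff L2_N_integrable CE_L2 F)
      then have "AE x in N. CE (- {k}) W x = CE (- {k}) (?\<Phi> n) x - CE (- {k}) F x"
        by (rule AE_N_eqI) (intro CE_measurable_N borel_measurable_diff)+
      then show "AE x in N. D k (?\<Phi> n) x - D k F x = D k W x"
        by eventually_elim (simp add: W_def malliavin_D_def)
    qed (intro D_L2 L2_space_diff CE_L2 F W)+
    ultimately show ?thesis
      using energy_has_sum(2)[OF Ww Ww] D_L2[OF F] D_L2[OF CE_L2[OF F]]
      by (intro kappa_L2(2)) (auto simp: L2_norm_square)
  qed
  have "(\<lambda>n. energy F F - sum ?b (Pow {..<n})) \<longlonglongrightarrow> energy F F - energy F F"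
    using b unfolding has_sum_def
    by (intro tendsto_diff tendsto_const) (rule filterlim_compose[OF _ filterlim_Pow_lessThan])
  then have "(\<lambda>n. sqrt ((L2_norm ?K (\<lambda>z. malliavin_D P E X (?\<Phi> n) z - malliavin_D P E X F z))\<^sup>2)) \<longlonglongrightarrow> sqrt 0"
    unfolding norm by (intro tendsto_real_sqrt) simp
  then have "(\<lambda>n. L2_norm ?K (\<lambda>z. malliavin_D P E X (?\<Phi> n) z - malliavin_D P E X F z)) \<longlonglongrightarrow> 0"
    by simp
  then have "(F, malliavin_D P E X F) \<in> malliavin_graph P E X"
    using F malliavin_D_kappa(1)[OF Fw] core CE_tendsto[OF F]
    by (auto simp: malliavin_graph_def intro!: exI[of _ ?\<Phi>])
  then show "F \<in> malliavin_dom P E X" by (auto simp: malliavin_dom_def)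
qed

lemma malliavin_dom_eq: "malliavin_dom P E X = hoeffding.weight_dom w1"
  using malliavin_dom_subset weight_dom_subset_malliavin_dom by blast

section \<open>Divergence and generator\<close>

lemma D_pairing:
  assumes F: "F \<in> hoeffding.weight_dom w1" and G: "G \<in> hoeffding.weight_dom w1"
  shows "(\<Sum>k. \<integral>\<omega>. D k F \<omega> * D k G \<omega> \<partial>P) = energy F G"
proof -
  have "(\<integral>\<omega>. D k F \<omega> * D k G \<omega> \<partial>P) = L2_inner N (D k F) (D k G)" for k
    using F G by (intro L2_inner_N(1)[symmetric] D_L2) (auto dest: hoeffding.weight_domD)
  then show ?thesis
    using has_sum_imp_sums[OF energy_has_sum(2)[OF F G]] by (simp add: sums_iff)
qed

text \<open>Integration by parts: the factor \<open>card M\<close> is moved from the form onto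
  \<open>F\<close>. It shows that \<open>H\<close> has the defining property of the divergence of
  \<open>D F\<close>.\<close>

lemma energy_multiplier:
  assumes F: "F \<in> hoeffding.weight_dom w1" and G: "G \<in> hoeffding.weight_dom w1" and H: "H \<in> L2_space N"
    and mult: "\<And>M. finite M \<Longrightarrow> AE x in N. hoeff M H x = real (card M) * hoeff M F x"
  shows "energy G F = L2_inner N G H"
proof -
  have "((\<lambda>M. real (card M) * L2_inner N (hoeff M F) (hoeff M G)) has_sum L2_inner N H G) {M. finite M}"
    using F G H mult by (intro hoeffding.multiplier_inner_has_sum) (auto dest: hoeffding.weight_domD)
  moreover have "((\<lambda>M. real (card M) * L2_inner N (hoeff M F) (hoeff M G)) has_sum energy G F) {M. finite M}"
    using energy_has_sum(1)[OF G F] by (subst L2_inner_commute)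
  ultimately show ?thesis by (metis has_sum_unique L2_inner_commute)
qed

text \<open>Levels are natural numbers, and \<open>n \<le> n\<^sup>2\<close> there.\<close>

lemma weight_dom_square_subset: "hoeffding.weight_dom w2 \<subseteq> hoeffding.weight_dom w1"
proof
  fix F assume F: "F \<in> hoeffding.weight_dom w2"
  have le: "real n \<le> (real n)\<^sup>2" for n :: nat
    by (cases "n = 0") (auto simp: power2_eq_square)
  have "(\<lambda>M. real (card M) * (L2_norm N (hoeff M F))\<^sup>2) summable_on {M. finite M}"
  proof (rule summable_on_comparison_test)
    show "(\<lambda>M. (real (card M))\<^sup>2 * (L2_norm N (hoeff M F))\<^sup>2) summable_on {M. finite M}"
      using F by (simp add: hoeffding.weight_dom_def)
    show "real (card M) * (L2_norm N (hoeff M F))\<^sup>2 \<le> (real (card M))\<^sup>2 * (L2_norm N (hoeff M F))\<^sup>2" for M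
      by (intro mult_right_mono le) simp
  qed simp
  then show "F \<in> hoeffding.weight_dom w1" using F by (simp add: hoeffding.weight_dom_def)
qed

lemma OU_dom_eq: "OU_dom P E X = hoeffding.weight_dom w2"
proof (intro equalityI subsetI)
  fix F assume "F \<in> OU_dom P E X"
  then obtain C where Fw: "F \<in> hoeffding.weight_dom w1"
    and C: "\<And>G. G \<in> hoeffding.weight_dom w1 \<Longrightarrow> \<bar>\<Sum>k. \<integral>\<omega>. D k G \<omega> * D k F \<omega> \<partial>P\<bar> \<le> C * L2_norm N G"
    by (auto simp: OU_dom_def divergence_dom_def malliavin_dom_eq)
  have F: "F \<in> L2_space N" using Fw by (rule hoeffding.weight_domD)
  show "F \<in> hoeffding.weight_dom w2"
  proof (rule hoeffding.weight_domI_bounded_functional[OF F])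
    fix A :: "nat set set" assume A: "finite A" "A \<subseteq> {M. finite M}"
    \<comment> \<open>The truncation of the prospective divergence of \<open>D F\<close>; its energy
      against \<open>F\<close> is the partial sum to be bounded.\<close>
    let ?G = "\<lambda>x. \<Sum>M\<in>A. real (card M) * hoeff M F x"
    have G: "?G \<in> hoeffding.weight_dom w1"
      by (rule hoeffding.combination_weight_dom[OF A(2,1) F])
    have "real (card M) * L2_inner N (hoeff M ?G) (hoeff M F)
        = (if M \<in> A then (real (card M))\<^sup>2 * (L2_norm N (hoeff M F))\<^sup>2 else 0)" if M: "finite M" for M
    proof -
      have "L2_inner N (hoeff M ?G) (hoeff M F)
          = L2_inner N (\<lambda>x. (if M \<in> A then real (card M) else 0) * hoeff M F x) (hoeff M F)"
        using hoeffding.component_combination[OF A(2,1) F, of M "\<lambda>M. real (card M)"] M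
        by (intro L2_inner_cong_AE) (auto intro: hoeff_L2 L2_space_cmult hoeffding.weight_domD[OF G] F)
      then show ?thesis
        by (simp add: L2_inner_cmult_left power2_eq_square flip: L2_norm_square)
    qed
    then have "((\<lambda>M. real (card M) * L2_inner N (hoeff M ?G) (hoeff M F)) has_sum
        (\<Sum>M\<in>A. (real (card M))\<^sup>2 * (L2_norm N (hoeff M F))\<^sup>2)) {M. finite M}"
      using A by (intro has_sum_finite_neutralI[of A]) (auto intro!: sum.cong dest: subsetD)
    from has_sum_unique[OF energy_has_sum(1)[OF G Fw] this]
    show "(\<Sum>M\<in>A. (real (card M))\<^sup>2 * (L2_norm N (hoeff M F))\<^sup>2) \<le> C * L2_norm N ?G"
      using C[OF G] by (simp add: D_pairing[OF G Fw])
  qed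
next
  fix F assume Fw2: "F \<in> hoeffding.weight_dom w2"
  then have Fw: "F \<in> hoeffding.weight_dom w1" using weight_dom_square_subset by blast
  obtain H where H: "H \<in> L2_space N"
    and mult: "\<And>M. finite M \<Longrightarrow> AE x in N. hoeff M H x = real (card M) * hoeff M F x"
    using hoeffding.multiplier_exists[OF Fw2] by auto
  have "\<bar>\<Sum>k. \<integral>\<omega>. D k G \<omega> * D k F \<omega> \<partial>P\<bar> \<le> L2_norm N H * L2_norm N G"
    if G: "G \<in> hoeffding.weight_dom w1" for G
  proof -
    have "energy G F = L2_inner N G H" using Fw G H mult by (rule energy_multiplier)
    then show ?thesis
      unfolding D_pairing[OF G Fw]
      using L2_Cauchy_Schwarz[OF hoeffding.weight_domD[OF G] H] by (simp add: mult.commute)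
  qed
  then show "F \<in> OU_dom P E X"
    using Fw malliavin_D_kappa(1)[OF Fw] by (auto simp: OU_dom_def divergence_dom_def malliavin_dom_eq)
qed

text \<open>The multiplier \<open>H\<close> from \<open>multiplier_exists\<close> witnesses the
  specification behind \<open>SOME\<close>, so the chosen function satisfies it as well; agreement
  of the pairings on the dense domain of \<open>D\<close> makes the two equal almost
  everywhere.\<close>

lemma divergence_D:
  assumes Fw2: "F \<in> hoeffding.weight_dom w2"
  shows "divergence P E X (malliavin_D P E X F) \<in> L2_space N"
    and "finite M \<Longrightarrow> AE x in N. hoeff M (divergence P E X (malliavin_D P E X F)) x = real (card M) * hoeff M F x"
proof -
  have Fw: "F \<in> hoeffding.weight_dom w1" using Fw2 weight_dom_square_subset by blast
  obtain H where H: "H \<in> L2_space N"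
    and mult: "\<And>M. finite M \<Longrightarrow> AE x in N. hoeff M H x = real (card M) * hoeff M F x"
    using hoeffding.multiplier_exists[OF Fw2] by auto
  let ?\<delta> = "divergence P E X (malliavin_D P E X F)"
  let ?Q = "\<lambda>H. H \<in> L2_space N \<and> (\<forall>G\<in>malliavin_dom P E X.
    (\<integral>\<omega>. G \<omega> * H \<omega> \<partial>P) = (\<Sum>k. \<integral>\<omega>. D k G \<omega> * D k F \<omega> \<partial>P))"
  have "?Q H"
    unfolding malliavin_dom_eq
    using H by (simp add: D_pairing Fw energy_multiplier[OF Fw _ H mult] L2_inner_N(1) hoeffding.weight_domD)
  then have Q: "?Q ?\<delta>" unfolding divergence_def by (rule someI[of ?Q])
  then show \<delta>: "?\<delta> \<in> L2_space N" by blast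
  have eq: "AE x in N. ?\<delta> x = H x"
  proof (rule hoeffding.AE_eqI_inner_weight_dom[OF \<delta> H])
    fix G assume G: "G \<in> hoeffding.weight_dom w1"
    have "L2_inner N G ?\<delta> = energy G F"
      using Q G by (simp add: malliavin_dom_eq D_pairing Fw L2_inner_N(1)[OF hoeffding.weight_domD[OF G] \<delta>])
    then show "L2_inner N G ?\<delta> = L2_inner N G H"
      using energy_multiplier[OF Fw G H mult] by simp
  qed
  show "AE x in N. hoeff M ?\<delta> x = real (card M) * hoeff M F x" if "finite M"
    using hoeffding.component_cong[OF _ \<delta> H eq, simplified, OF that] mult[OF that]
    by eventually_elim simp
qed

sublocale OU: L2_number_operator N "\<lambda>M F. hoeff M F" "{M. finite M}" card "OU_dom P E X" "OU_gen P E X"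
proof (unfold_locales, goal_cases)
  case 1
  show ?case by (rule OU_dom_eq)
next
  case (2 F)
  then show ?case unfolding OU_gen_def by (intro L2_space_uminus divergence_D) (simp add: OU_dom_eq)
next
  case (3 F M)
  then have F: "F \<in> hoeffding.weight_dom w2" and M: "finite M" by (auto simp: OU_dom_eq)
  have "AE x in N. hoeff M (OU_gen P E X F) x = -1 * hoeff M (divergence P E X (malliavin_D P E X F)) x"
    using hoeffding.component_cmult[OF _ divergence_D(1)[OF F], of M "-1"] M by (simp add: OU_gen_def)
  then show ?case using divergence_D(2)[OF F M] by eventually_elim simp
qed

end

theorem proposition2p10:
  fixes P :: "'a measure" and E :: "nat \<Rightarrow> 'e measure" and X :: "nat \<Rightarrow> 'a \<Rightarrow> 'e"
  assumes "prob_space P"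
    and "\<And>n. prob_space (E n)"
    and "prob_space.indep_vars P E X UNIV"
    and "\<And>n. distr P (E n) (X n) = E n"
  shows "L2_self_adjoint (PF P E X) (OU_dom P E X) (OU_gen P E X) \<and>
    (\<forall>F\<in>OU_dom P E X. (\<integral>\<omega>. F \<omega> * (- OU_gen P E X F \<omega>) \<partial>P) \<ge> 0) \<and>
    spectrum (PF P E X) (OU_dom P E X) (OU_gen P E X) =
      point_spectrum (PF P E X) (OU_dom P E X) (OU_gen P E X) \<and>
    point_spectrum (PF P E X) (OU_dom P E X) (OU_gen P E X) \<subseteq> {real_of_int p | p. p \<le> 0} \<and>
    (\<forall>p::nat. - real p \<in> point_spectrum (PF P E X) (OU_dom P E X) (OU_gen P E X) \<longrightarrow>
       eigenspace (PF P E X) (OU_dom P E X) (OU_gen P E X) (- real p) = hoeffding_space P E X p)"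
proof -
  interpret prob_space P by fact
  interpret independent_sequence P E X
    by unfold_locales (fact assms(3))
  show ?thesis
  proof (intro conjI ballI allI impI)
    fix F assume F: "F \<in> OU_dom P E X"
    have "(\<integral>\<omega>. F \<omega> * (- OU_gen P E X F \<omega>) \<partial>P) = - L2_inner N (OU_gen P E X F) F"
      using L2_inner_N(1)[OF OU.op_L2[OF F] OU.dom_L2[OF F]] by (simp add: mult.commute)
    then show "(\<integral>\<omega>. F \<omega> * (- OU_gen P E X F \<omega>) \<partial>P) \<ge> 0"
      using OU.op_negative[OF F] by simp
  next
    fix p :: nat
    show "eigenspace N (OU_dom P E X) (OU_gen P E X) (- real p) = hoeffding_space P E X p"
      unfolding OU.eigenspace_eq hoeffding_space_def hoeffding_part_def by simp
  qed (rule OU.self_adjoint OU.spectrum_eq_point_spectrum OU.point_spectrum_subset)+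
qed

end
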